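(* Let $H_3$ be the 3-dimensional Heisenberg group, regarded as the homogeneous space $G/H$ with $H=\mathrm{SO}(2)$ and $G=H_3\rtimes\mathrm{SO}(2)$. There exists a family of Finsler $(\alpha_1,\alpha_2)$ metrics $F$ on $H_3$ which arise as $F=\sqrt{L(\sqrt{g_1},\sqrt{g_2})}$, where $g_1,g_2$ are naturally reductive Riemannian metrics on $H_3$ and $L$ is an admissible function, such that these Finsler metrics are g.o., but not naturally reductive.
   Context: The Lie algebra $\mathfrak n$ of $H_3$ has a basis $E_1,E_2,E_3$ with the only nontrivial bracket $[E_1,E_2]=E_3$. The Lie algebra $\mathfrak h$ of $H=\mathrm{SO}(2)$ is generated by the operator $D$ with $D(E_1)=E_2$, $D(E_2)=-E_1$, $D(E_3)=0$. The reductive decomposition is $\mathfrak g=\mathfrak m+\mathfrak h$ with $\mathfrak m=\mathfrak n=\mathfrak m_1\oplus\mathfrak m_2$, $\mathfrak m_1=\mathrm{span}(E_1,E_2)$, $\mathfrak m_2=\mathrm{span}(E_3)$. Let $\alpha_1,\alpha_2$ be the scalar products on $\mathfrak m_1,\mathfrak m_2$ making $\{E_1,E_2\}$, $\{E_3\}$ orthonormal. The invariant metrics $\alpha_1+c\,\alpha_2$, $c>0$, are naturally reductive Riemannian metrics on $G/H$. $\mathfrak m$ is identified with the tangent space at the origin $p$, and invariant Finsler (Riemannian) metrics on $G/H$ correspond to $\mathrm{Ad}(H)$-invariant Minkowski norms (scalar products) on $\mathfrak m$. A Finsler metric is an $(\alpha_1,\alpha_2)$ metric if its Minkowski norm on $\mathfrak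 m$ has the form $F(y)=f(\alpha_1(y_1),\alpha_2(y_2))$ for a function $f\colon[0,\infty)^2\to\mathbb R$, smooth away from the origin, where $y_i$ is the projection of $y$ on $\mathfrak m_i$ and $\alpha_i(y_i)=\alpha_i(y_i,y_i)$. $(G/H,F)$ is g.o. if every geodesic through $p$ is of the form $\exp(ty)(p)$ with $y\in\mathfrak g$. $(G/H,F)$ is naturally reductive if there exists a reductive decomposition $\mathfrak g=\mathfrak h+\mathfrak m'$ ($\mathfrak m'$ an $\mathrm{Ad}(H)$-invariant complement) such that the geodesics through $p$ are of the form $\exp(ty)(p)$ with $y\in\mathfrak m'$; for a Riemannian metric this is required in the form $\langle[z,x]_{\mathfrak m'},y\rangle+\langle x,[z,y]_{\mathfrak m'}\rangle=0$ for all $x,y,z\in\mathfrak m'$. An admissible function $L$ of two variables is a continuous function, smooth and positive away from $0$, positively homogeneous of degree 2, with $L_{,1},L_{,2}\ge0$, $\mathrm{Hess}(L)$ positive semi-definite and $L_{,1}+L_{,2}>0$, where $L_{,i}$ is the derivative with respect to the $i$-th variable. *)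

theory Defs
  imports "HOL-Analysis.Analysis"
begin

text \<open>
  Smoothness of maps between Euclidean spaces. The definition is intended for open \<open>S\<close>, where
  \<^term>\<open>frechet_derivative f (at x)\<close> is the total derivative of \<open>f\<close> at \<open>x\<close>.
\<close>

primrec Ck_on ::
    "nat \<Rightarrow> 'a::euclidean_space set \<Rightarrow> ('a \<Rightarrow> 'b::euclidean_space) \<Rightarrow> bool" where
  "Ck_on 0 S f \<longleftrightarrow> continuous_on S f"
| "Ck_on (Suc k) S f \<longleftrightarrow> (\<forall>x\<in>S. f differentiable (at x)) \<and>
     (\<forall>v. Ck_on k S (\<lambda>x. frechet_derivative f (at x) v))"

definition smooth_on ::
    "'a::euclidean_space set \<Rightarrow> ('a \<Rightarrow> 'b::euclidean_space) \<Rightarrow> bool" where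
  "smooth_on S f \<longleftrightarrow> (\<forall>k. Ck_on k S f)"

definition hess :: "('a::euclidean_space \<Rightarrow> real) \<Rightarrow> 'a \<Rightarrow> 'a \<Rightarrow> 'a \<Rightarrow> real" where
  "hess f x u v = frechet_derivative (\<lambda>z. frechet_derivative f (at z) v) (at x) u"

text \<open>
  The Heisenberg group in exponential coordinates: \<open>(z, t)\<close> stands for
  \<open>exp (Re z E\<^sub>1 + Im z E\<^sub>2 + t E\<^sub>3)\<close>, and the product is given by the
  Baker-Campbell-Hausdorff formula \<open>X * Y = X + Y + [X, Y] / 2\<close>. The same type carries the Lie
  algebra \<open>\<nn> = \<mm>\<close>, which is also the tangent space at the origin.
\<close>

type_synonym heis = "complex \<times> real"

definition E1 :: heis where "E1 = (1, 0)"
definition E2 :: heis where "E2 = (\<i>, 0)"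
definition E3 :: heis where "E3 = (0, 1)"

definition heis_bracket :: "heis \<Rightarrow> heis \<Rightarrow> heis" where
  "heis_bracket X Y =
     (0, Re (fst X) * Im (fst Y) - Im (fst X) * Re (fst Y))"

definition heis_mult :: "heis \<Rightarrow> heis \<Rightarrow> heis" where
  "heis_mult x y = x + y + (1/2) *\<^sub>R heis_bracket x y"

definition heis_inv :: "heis \<Rightarrow> heis" where
  "heis_inv x = - x"

definition derD :: "heis \<Rightarrow> heis" where
  "derD X = (\<i> * fst X, 0)"

lemma heis_bracket_basis:
  "heis_bracket E1 E2 = E3" "heis_bracket E1 E3 = 0" "heis_bracket E2 E3 = 0"
  by (simp_all add: heis_bracket_def E1_def E2_def E3_def zero_prod_def)

lemma derD_basis: "derD E1 = E2" "derD E2 = - E1" "derD E3 = 0"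
  by (simp_all add: derD_def E1_def E2_def E3_def zero_prod_def)

text \<open>
  \<open>SO(2)\<close> is the group of unit complex numbers; it acts on \<open>H\<^sub>3\<close> by the automorphisms
  \<open>rot u = exp (\<theta> D)\<close> for \<open>u = cis \<theta>\<close>. Elements of \<open>G = H\<^sub>3 \<rtimes> SO(2)\<close>
  are pairs \<open>(x, u)\<close>, and \<open>G / H\<close> is identified with \<open>H\<^sub>3\<close> by \<open>(x, u) H \<mapsto> x\<close>.
\<close>

definition SO2 :: "complex set" where
  "SO2 = {u. norm u = 1}"

definition rot :: "complex \<Rightarrow> heis \<Rightarrow> heis" where
  "rot u x = (u * fst x, snd x)"

type_synonym grp = "heis \<times> complex"

definition G_set :: "grp set" where
  "G_set = UNIV \<times> SO2"

definition G_mult :: "grp \<Rightarrow> grp \<Rightarrow> grp" where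
  "G_mult g h = (heis_mult (fst g) (rot (snd g) (fst h)), snd g * snd h)"

definition G_act :: "grp \<Rightarrow> heis \<Rightarrow> heis" where
  "G_act g x = heis_mult (fst g) (rot (snd g) x)"

definition origin :: heis where
  "origin = 0"

lemma heis_bracket_rot:
  assumes "u \<in> SO2"
  shows "heis_bracket (rot u x) (rot u y) = heis_bracket x y"
proof -
  have u: "Re u * Re u + Im u * Im u = 1"
    using assms by (simp add: SO2_def cmod_def power2_eq_square)
  have "Re (u * a) * Im (u * b) - Im (u * a) * Re (u * b)
      = (Re u * Re u + Im u * Im u) * (Re a * Im b - Im a * Re b)" for a b :: complex
    by (simp add: algebra_simps)
  then have "Re (u * a) * Im (u * b) - Im (u * a) * Re (u * b) = Re a * Im b - Im a * Re b"
    for a b :: complex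
    unfolding u by simp
  then show ?thesis
    unfolding heis_bracket_def rot_def fst_conv by simp
qed

lemma rot_heis_mult:
  assumes "u \<in> SO2"
  shows "rot u (heis_mult x y) = heis_mult (rot u x) (rot u y)"
  unfolding heis_mult_def heis_bracket_rot[OF assms]
  by (simp add: rot_def heis_bracket_def prod_eq_iff algebra_simps)

lemma heis_mult_assoc: "heis_mult (heis_mult x y) z = heis_mult x (heis_mult y z)"
  by (simp add: heis_mult_def heis_bracket_def prod_eq_iff field_simps)

lemma G_act_G_mult:
  assumes "g \<in> G_set"
  shows "G_act (G_mult g h) x = G_act g (G_act h x)"
proof -
  have "rot (snd g * snd h) x = rot (snd g) (rot (snd h) x)"
    by (simp add: rot_def mult.assoc)
  moreover have "snd g \<in> SO2"
    using assms by (auto simp: G_set_def)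
  ultimately show ?thesis
    by (simp add: G_act_def G_mult_def rot_heis_mult heis_mult_assoc)
qed

text \<open>
  An element \<open>(X, s)\<close> of the following type is \<open>X + s D\<close> in \<open>\<gg> = \<mm> + \<hh>\<close>. The
  first component of an element is its class in \<open>\<gg> / \<hh>\<close>, i.e. the tangent vector at
  the origin that it induces.
\<close>

type_synonym lie_g = "heis \<times> real"

definition lie_h :: "lie_g set" where
  "lie_h = {0} \<times> UNIV"

definition lie_bracket :: "lie_g \<Rightarrow> lie_g \<Rightarrow> lie_g" where
  "lie_bracket a b =
     (heis_bracket (fst a) (fst b) + snd a *\<^sub>R derD (fst b) - snd b *\<^sub>R derD (fst a), 0)"

text \<open>
  The differential of conjugation by \<open>(0, u)\<close>; it is trivial on \<open>\<hh>\<close> because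
  \<open>SO(2)\<close> is abelian.
\<close>

definition Ad_H :: "complex \<Rightarrow> lie_g \<Rightarrow> lie_g" where
  "Ad_H u a = (rot u (fst a), snd a)"

text \<open>
  The tangent space of \<open>SO(2)\<close> at \<open>1\<close> consists of the purely imaginary numbers, and \<open>D\<close>
  corresponds to \<open>\<i>\<close>.
\<close>

definition one_param_subgroup :: "lie_g \<Rightarrow> (real \<Rightarrow> grp) \<Rightarrow> bool" where
  "one_param_subgroup y \<gamma> \<longleftrightarrow>
     range \<gamma> \<subseteq> G_set \<and>
     (\<forall>s t. \<gamma> (s + t) = G_mult (\<gamma> s) (\<gamma> t)) \<and>
     (\<gamma> has_vector_derivative (fst y, complex_of_real (snd y) * \<i>)) (at 0)"

definition lie_exp :: "lie_g \<Rightarrow> grp" where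
  "lie_exp y = (THE g. \<exists>\<gamma>. one_param_subgroup y \<gamma> \<and> g = \<gamma> 1)"

definition minkowski_norm :: "('a::euclidean_space \<Rightarrow> real) \<Rightarrow> bool" where
  "minkowski_norm F \<longleftrightarrow>
     smooth_on (UNIV - {0}) F \<and>
     (\<forall>y. y \<noteq> 0 \<longrightarrow> F y > 0) \<and>
     (\<forall>r>0. \<forall>y. F (r *\<^sub>R y) = r * F y) \<and>
     (\<forall>y v. y \<noteq> 0 \<longrightarrow> v \<noteq> 0 \<longrightarrow> hess (\<lambda>z. (F z)\<^sup>2 / 2) y v v > 0)"

definition invariant_finsler :: "(heis \<Rightarrow> real) \<Rightarrow> bool" where
  "invariant_finsler F \<longleftrightarrow> minkowski_norm F \<and> (\<forall>u\<in>SO2. \<forall>y. F (rot u y) = F y)"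

definition finsler :: "(heis \<Rightarrow> real) \<Rightarrow> heis \<Rightarrow> heis \<Rightarrow> real" where
  "finsler F x v = F (frechet_derivative (\<lambda>q. heis_mult (heis_inv x) q) (at x) v)"

definition energy :: "(heis \<Rightarrow> real) \<Rightarrow> heis \<Rightarrow> heis \<Rightarrow> real" where
  "energy F x v = (finsler F x v)\<^sup>2 / 2"

text \<open>
  Geodesics (parametrized with constant speed) are the regular smooth curves satisfying the
  Euler-Lagrange equations of the energy,
  \<open>d/dt (\<partial>E/\<partial>v (c, c')) = \<partial>E/\<partial>x (c, c')\<close>, written here in the global
  coordinates of \<open>H\<^sub>3\<close> and tested against an arbitrary direction \<open>w\<close>.
\<close>

definition velocity :: "(real \<Rightarrow> heis) \<Rightarrow> real \<Rightarrow> heis" where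
  "velocity c t = vector_derivative c (at t)"

definition geodesic_on :: "(heis \<Rightarrow> real) \<Rightarrow> real set \<Rightarrow> (real \<Rightarrow> heis) \<Rightarrow> bool" where
  "geodesic_on F I c \<longleftrightarrow>
     open I \<and> is_interval I \<and> smooth_on I c \<and>
     (\<forall>t\<in>I. velocity c t \<noteq> 0) \<and>
     (\<forall>t\<in>I. \<forall>w.
        ((\<lambda>\<tau>. frechet_derivative (energy F (c \<tau>)) (at (velocity c \<tau>)) w)
           has_real_derivative
         frechet_derivative (\<lambda>x. energy F x (velocity c t)) (at (c t)) w) (at t))"

definition geodesics_are_orbits_of :: "(heis \<Rightarrow> real) \<Rightarrow> lie_g set \<Rightarrow> bool" where
  "geodesics_are_orbits_of F S \<longleftrightarrow>
     (\<forall>I c. geodesic_on F I c \<and> 0 \<in> I \<and> c 0 = origin \<longrightarrow>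
        (\<exists>y\<in>S. \<forall>t\<in>I. c t = G_act (lie_exp (t *\<^sub>R y)) origin))"

definition geodesic_orbit :: "(heis \<Rightarrow> real) \<Rightarrow> bool" where
  "geodesic_orbit F \<longleftrightarrow> geodesics_are_orbits_of F UNIV"

definition reductive_complement :: "lie_g set \<Rightarrow> bool" where
  "reductive_complement m \<longleftrightarrow>
     subspace m \<and> m \<inter> lie_h = {0} \<and> {x + h |x h. x \<in> m \<and> h \<in> lie_h} = UNIV \<and>
     (\<forall>u\<in>SO2. Ad_H u ` m \<subseteq> m)"

definition naturally_reductive :: "(heis \<Rightarrow> real) \<Rightarrow> bool" where
  "naturally_reductive F \<longleftrightarrow>
     (\<exists>m. reductive_complement m \<and> geodesics_are_orbits_of F m)"

definition proj_along_h :: "lie_g set \<Rightarrow> lie_g \<Rightarrow> lie_g" where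
  "proj_along_h m z = (THE x. x \<in> m \<and> z - x \<in> lie_h)"

definition invariant_riemannian :: "(heis \<Rightarrow> heis \<Rightarrow> real) \<Rightarrow> bool" where
  "invariant_riemannian g \<longleftrightarrow>
     bilinear g \<and> (\<forall>x y. g x y = g y x) \<and> (\<forall>x. x \<noteq> 0 \<longrightarrow> g x x > 0) \<and>
     (\<forall>u\<in>SO2. \<forall>x y. g (rot u x) (rot u y) = g x y)"

text \<open>
  The scalar product on \<open>m\<close> is the one transported by the identification of \<open>m\<close> with
  the tangent space \<open>\<gg> / \<hh>\<close> at the origin, i.e. by \<^term>\<open>fst\<close>.
\<close>

definition naturally_reductive_riemannian :: "(heis \<Rightarrow> heis \<Rightarrow> real) \<Rightarrow> bool" where
  "naturally_reductive_riemannian g \<longleftrightarrow>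
     invariant_riemannian g \<and>
     (\<exists>m. reductive_complement m \<and>
        (\<forall>x\<in>m. \<forall>y\<in>m. \<forall>z\<in>m.
           g (fst (proj_along_h m (lie_bracket z x))) (fst y) +
           g (fst x) (fst (proj_along_h m (lie_bracket z y))) = 0))"

definition alpha1 :: "heis \<Rightarrow> heis \<Rightarrow> real" where
  "alpha1 x y = fst x \<bullet> fst y"

definition alpha2 :: "heis \<Rightarrow> heis \<Rightarrow> real" where
  "alpha2 x y = snd x * snd y"

definition quadrant :: "(real \<times> real) set" where
  "quadrant = {0..} \<times> {0..}"

text \<open>
  Smoothness on the closed quadrant away from the origin means existence of a smooth extension to
  an open neighbourhood. A total function represents a function on the quadrant together with such
  an extension, so its derivatives at boundary points are those of the function on the quadrant;
  values off that neighbourhood are irrelevant.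
\<close>

definition smooth_on_quadrant :: "(real \<times> real \<Rightarrow> real) \<Rightarrow> bool" where
  "smooth_on_quadrant f \<longleftrightarrow>
     (\<exists>U. open U \<and> quadrant - {0} \<subseteq> U \<and> smooth_on U f)"

definition alpha12_metric :: "(heis \<Rightarrow> real) \<Rightarrow> bool" where
  "alpha12_metric F \<longleftrightarrow>
     invariant_finsler F \<and>
     (\<exists>f. smooth_on_quadrant f \<and> (\<forall>y. F y = f (alpha1 y y, alpha2 y y)))"

definition admissible :: "(real \<times> real \<Rightarrow> real) \<Rightarrow> bool" where
  "admissible L \<longleftrightarrow>
     continuous_on quadrant L \<and> smooth_on_quadrant L \<and>
     (\<forall>r>0. \<forall>p\<in>quadrant. L (r *\<^sub>R p) = r\<^sup>2 * L p) \<and>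
     (\<forall>p\<in>quadrant - {0}.
        L p > 0 \<and>
        frechet_derivative L (at p) (1, 0) \<ge> 0 \<and>
        frechet_derivative L (at p) (0, 1) \<ge> 0 \<and>
        (\<forall>v. hess L p v v \<ge> 0) \<and>
        frechet_derivative L (at p) (1, 0) + frechet_derivative L (at p) (0, 1) > 0)"

end

theory Submission
  imports Defs
begin

text \<open>
  Let \<open>q\<^sub>c = \<alpha>\<^sub>1 + c \<alpha>\<^sub>2\<close> and \<open>F = (q\<^sub>a\<^sup>2 + q\<^sub>b\<^sup>2) powr (1/4)\<close>, that is,
  \<open>L(u, v) = sqrt (u\<^sup>4 + v\<^sup>4)\<close>. Written for the body velocity \<open>\<xi> = \<gamma>\<^sup>-\<^sup>1 \<gamma>'\<close> of a curve \<open>\<gamma>\<close>, the geodesic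
  equation is \<open>\<xi>' = \<kappa>(\<xi>) D \<xi>\<close> with a rotation invariant function \<open>\<kappa>\<close>; hence \<open>\<xi>\<close> rotates with
  constant speed and \<open>\<gamma>\<close> is the orbit of \<open>\<xi>(0) + \<kappa>(\<xi>(0)) D\<close>. An \<open>Ad(H)\<close>-invariant complement of \<open>\<hh>\<close>
  is the graph of \<open>X \<mapsto> l X\<^sub>3 D\<close>, so natural reductivity would make \<open>\<kappa>(X) / X\<^sub>3\<close> constant, which
  fails unless \<open>a = b\<close>.
\<close>

subsection \<open>Smooth functions\<close>

text \<open>Derivatives are taken at \<open>at x\<close>, not within \<open>S\<close>; openness of
  \<open>S\<close> makes them depend only on the values on \<open>S\<close>.\<close>

lemma Ck_on_cong:
  assumes "open S" "Ck_on k S f" "\<And>x. x \<in> S \<Longrightarrow> f x = g x"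
  shows "Ck_on k S g"
  using assms(2,3)
proof (induction k arbitrary: f g)
  case 0
  then show ?case by (simp cong: continuous_on_cong)
next
  case (Suc k)
  have d: "(g has_derivative frechet_derivative f (at x)) (at x)" if "x \<in> S" for x
    using Suc.prems that frechet_derivative_works
      has_derivative_transform_within_open[OF _ assms(1) that, of f]
    by (metis Ck_on.simps(2))
  then have eq: "frechet_derivative g (at x) = frechet_derivative f (at x)" if "x \<in> S" for x
    using that by (metis frechet_derivative_at)
  have "Ck_on k S (\<lambda>x. frechet_derivative g (at x) v)" for v
    using Suc.IH[of "\<lambda>x. frechet_derivative f (at x) v"] Suc.prems eq by simp
  moreover have "\<forall>x\<in>S. g differentiable (at x)"
    using d differentiableI by blast
  ultimately show ?case by simp
qed

text \<open>By uniqueness of derivatives an explicit \<open>f'\<close> may replace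
  \<open>frechet_derivative\<close>; the inductions below go through this rule.\<close>

lemma Ck_on_SucI:
  assumes "open S" "\<And>x. x \<in> S \<Longrightarrow> (f has_derivative f' x) (at x)"
    "\<And>v. Ck_on k S (\<lambda>x. f' x v)"
  shows "Ck_on (Suc k) S f"
proof -
  have "Ck_on k S (\<lambda>x. frechet_derivative f (at x) v)" for v
    using assms(2) by (intro Ck_on_cong[OF assms(1) assms(3)[of v]]) (metis frechet_derivative_at)
  then show ?thesis
    using assms(2) by (auto simp: differentiable_def)
qed

lemma Ck_on_SucD: "Ck_on (Suc k) S f \<Longrightarrow> Ck_on k S f"
proof (induction k arbitrary: f)
  case 0
  then show ?case
    by (auto intro!: continuous_at_imp_continuous_on differentiable_imp_continuous_within)
next
  case (Suc k)
  then show ?case by (metis Ck_on.simps(2))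
qed

lemma Ck_on_has_derivative:
  "Ck_on (Suc k) S f \<Longrightarrow> x \<in> S \<Longrightarrow> (f has_derivative frechet_derivative f (at x)) (at x)"
  using frechet_derivative_works by auto

lemma Ck_on_const: "Ck_on k S (\<lambda>x. c)"
  by (induction k arbitrary: c) simp_all

lemma Ck_on_linear:
  assumes "bounded_linear h" "open S" "Ck_on k S f"
  shows "Ck_on k S (\<lambda>x. h (f x))"
  using assms(3)
proof (induction k arbitrary: f)
  case 0
  then show ?case
    using bounded_linear.continuous_on[OF assms(1)] by simp
next
  case (Suc k)
  show ?case
  proof (rule Ck_on_SucI[OF assms(2)])
    show "((\<lambda>x. h (f x)) has_derivative (\<lambda>v. h (frechet_derivative f (at x) v))) (at x)"
      if "x \<in> S" for x
      using bounded_linear.has_derivative[OF assms(1)] Ck_on_has_derivative[OF Suc.prems that] .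
  qed (use Suc in auto)
qed

lemma Ck_on_id: "open S \<Longrightarrow> Ck_on k S (\<lambda>x. x)"
  by (cases k) (auto intro!: Ck_on_SucI[where f' = "\<lambda>x v. v"] Ck_on_const simp del: Ck_on.simps(2))

lemma Ck_on_add:
  assumes "open S" "Ck_on k S f" "Ck_on k S g"
  shows "Ck_on k S (\<lambda>x. f x + g x)"
  using assms(2,3)
proof (induction k arbitrary: f g)
  case 0
  then show ?case by (simp add: continuous_on_add)
next
  case (Suc k)
  show ?case
  proof (rule Ck_on_SucI[OF assms(1)])
    show "((\<lambda>x. f x + g x) has_derivative
        (\<lambda>v. frechet_derivative f (at x) v + frechet_derivative g (at x) v)) (at x)"
      if "x \<in> S" for x
      using Suc.prems that by (intro has_derivative_add Ck_on_has_derivative)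
  qed (use Suc in auto)
qed

text \<open>The Leibniz rule writes the derivative as a sum of two terms of the same bilinear shape,
  so the induction closes. The general form serves both multiplication and scalar products.\<close>

lemma Ck_on_bilinear:
  fixes prod :: "'b::euclidean_space \<Rightarrow> 'c::euclidean_space \<Rightarrow> 'd::euclidean_space"
  assumes "bounded_bilinear prod" "open S" "Ck_on k S f" "Ck_on k S g"
  shows "Ck_on k S (\<lambda>x. prod (f x) (g x))"
  using assms(3,4)
proof (induction k arbitrary: f g)
  case 0
  then show ?case by (simp add: bounded_bilinear.continuous_on[OF assms(1)])
next
  case (Suc k)
  show ?case
  proof (rule Ck_on_SucI[OF assms(2)])
    show "((\<lambda>x. prod (f x) (g x)) has_derivative
        (\<lambda>v. prod (f x) (frechet_derivative g (at x) v) + prod (frechet_derivative f (at x) v) (g x)))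
        (at x)" if "x \<in> S" for x
      using Suc.prems that by (intro bounded_bilinear.FDERIV[OF assms(1)] Ck_on_has_derivative)
    have "Ck_on k S f" "Ck_on k S g"
      using Suc.prems by (auto intro: Ck_on_SucD)
    then show "Ck_on k S (\<lambda>x. prod (f x) (frechet_derivative g (at x) v)
        + prod (frechet_derivative f (at x) v) (g x))" for v
      using Suc by (intro Ck_on_add assms(2)) auto
  qed
qed

lemmas Ck_on_mult = Ck_on_bilinear[OF bounded_bilinear_mult]

text \<open>Differentiation lowers the exponent by one, so the induction leaves \<open>r\<close>
  arbitrary.\<close>

lemma Ck_on_powr:
  fixes f :: "'a::euclidean_space \<Rightarrow> real"
  assumes "open S" "Ck_on k S f" "\<And>x. x \<in> S \<Longrightarrow> f x > 0"
  shows "Ck_on k S (\<lambda>x. f x powr r)"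
  using assms(2)
proof (induction k arbitrary: r)
  case 0
  then show ?case using assms(3) by (force intro: continuous_on_powr)
next
  case (Suc k)
  show ?case
  proof (rule Ck_on_SucI[OF assms(1)])
    show "((\<lambda>x. f x powr r) has_derivative
      (\<lambda>v. r * (f x powr (r - 1) * frechet_derivative f (at x) v))) (at x)" if "x \<in> S" for x
      using assms(3)[OF that]
      by (auto intro!: derivative_eq_intros Ck_on_has_derivative[OF Suc.prems that]
          simp: powr_diff field_simps fun_eq_iff)
    have "Ck_on k S (\<lambda>x. f x powr (r - 1))"
      by (rule Suc.IH[OF Ck_on_SucD[OF Suc.prems]])
    then show "Ck_on k S (\<lambda>x. r * (f x powr (r - 1) * frechet_derivative f (at x) v))" for v
      using Suc.prems by (intro Ck_on_mult Ck_on_const assms(1)) auto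
  qed
qed

text \<open>Both functions are treated in one induction because differentiation exchanges
  them.\<close>

lemma Ck_on_cos_sin:
  "Ck_on k UNIV (\<lambda>t::real. cos (a * t)) \<and> Ck_on k UNIV (\<lambda>t. sin (a * t))"
proof (induction k)
  case 0
  then show ?case by (auto intro!: continuous_intros)
next
  case (Suc k)
  have "Ck_on (Suc k) UNIV (\<lambda>t. cos (a * t))"
  proof (rule Ck_on_SucI)
    show "((\<lambda>t. cos (a * t)) has_derivative (\<lambda>v. - a * v * sin (a * t))) (at t)" for t
      by (auto intro!: derivative_eq_intros)
  qed (intro Ck_on_mult Ck_on_const open_UNIV conjunct1[OF Suc] conjunct2[OF Suc])+
  moreover have "Ck_on (Suc k) UNIV (\<lambda>t. sin (a * t))"
  proof (rule Ck_on_SucI)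
    show "((\<lambda>t. sin (a * t)) has_derivative (\<lambda>v. a * v * cos (a * t))) (at t)" for t
      by (auto intro!: derivative_eq_intros)
  qed (intro Ck_on_mult Ck_on_const open_UNIV conjunct1[OF Suc] conjunct2[OF Suc])+
  ultimately show ?case by blast
qed

section \<open>Hessians and square roots\<close>

lemma hess_eqI:
  assumes "open S" "y \<in> S" "\<And>z. z \<in> S \<Longrightarrow> (f has_derivative f' z) (at z)"
    "((\<lambda>z. f' z v) has_derivative f'') (at y)"
  shows "hess f y u v = f'' u"
proof -
  have "((\<lambda>z. frechet_derivative f (at z) v) has_derivative f'') (at y)"
    using assms(4,1,2)
    by (rule has_derivative_transform_within_open) (metis assms(3) frechet_derivative_at)
  from frechet_derivative_at[OF this, symmetric] show ?thesis
    by (simp add: hess_def)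
qed

lemma has_derivative_sqrt:
  assumes "(P has_derivative P') (at z)" "P z > 0"
  shows "((\<lambda>z. sqrt (P z)) has_derivative (\<lambda>v. P' v / (2 * sqrt (P z)))) (at z)"
  using assms by (auto intro!: derivative_eq_intros simp: field_simps)

text \<open>With \<open>R\<close> the derivative of \<open>P\<close> in a fixed direction, this
  quotient rule yields the Hessian of \<open>sqrt P\<close>. It is applied both to the norm and to
  \<open>L\<close>.\<close>

lemma has_derivative_sqrt_derivative:
  assumes "(P has_derivative P') (at y)" "P y > 0" "(R has_derivative R') (at y)"
  shows "((\<lambda>z. R z / (2 * sqrt (P z))) has_derivative
    (\<lambda>u. R' u / (2 * sqrt (P y)) - P' u * R y / (4 * P y * sqrt (P y)))) (at y)"
proof -
  have d: "((\<lambda>z. 2 * sqrt (P z)) has_derivative (\<lambda>u. P' u / sqrt (P y))) (at y)"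
    using assms(1,2) by (auto intro!: derivative_eq_intros simp: field_simps)
  have "(R' u * (2 * s) - R y * (P' u / s)) / (2 * s * (2 * s))
      = R' u / (2 * s) - P' u * R y / (4 * (s * s) * s)" if "s > 0" for u and s :: real
    using that by (simp add: field_simps)
  from this[of "sqrt (P y)"] show ?thesis
    using has_derivative_divide'[OF assms(3) d] assms(2) by simp
qed

subsection \<open>Norms built from two scalar products\<close>

definition quad :: "real \<Rightarrow> heis \<Rightarrow> heis \<Rightarrow> real" where
  "quad c x y = fst x \<bullet> fst y + c * (snd x * snd y)"

lemma quad_eq_alpha: "quad c x y = alpha1 x y + c * alpha2 x y"
  by (simp add: quad_def alpha1_def alpha2_def)

lemma bounded_bilinear_quad: "bounded_bilinear (quad c)"
proof -
  have "bilinear (quad c)"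
    unfolding bilinear_def by (auto intro!: linearI simp: quad_def algebra_simps inner_simps)
  then show ?thesis by (rule bilinear_conv_bounded_bilinear[THEN iffD1])
qed

lemmas quad_simps =
  bounded_bilinear.add_left[OF bounded_bilinear_quad] bounded_bilinear.add_right[OF bounded_bilinear_quad]
  bounded_bilinear.diff_left[OF bounded_bilinear_quad] bounded_bilinear.diff_right[OF bounded_bilinear_quad]
  bounded_bilinear.scaleR_left[OF bounded_bilinear_quad] bounded_bilinear.scaleR_right[OF bounded_bilinear_quad]
lemma quad_commute: "quad c x y = quad c y x"
  by (simp add: quad_def inner_commute mult.commute)

lemma quad_pos: "c > 0 \<Longrightarrow> x \<noteq> 0 \<Longrightarrow> quad c x x > 0"
  by (cases "fst x = 0")
     (auto simp: quad_def prod_eq_iff zero_less_mult_iff intro!: add_pos_nonneg)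

lemma quad_rot: "u \<in> SO2 \<Longrightarrow> quad c (rot u x) (rot u y) = quad c x y"
proof -
  assume "u \<in> SO2"
  then have u: "Re u * Re u + Im u * Im u = 1"
    by (simp add: SO2_def cmod_def power2_eq_square)
  have "(u * z) \<bullet> (u * w) = (Re u * Re u + Im u * Im u) * (z \<bullet> w)" for z w
    by (simp add: inner_complex_def algebra_simps)
  then show ?thesis by (simp add: quad_def rot_def u)
qed

text \<open>Rotation by a right angle turns the scalar product on \<open>span(E1, E2)\<close> into
  the area form, which is also the bracket. As \<open>derD x\<close> has no \<open>E3\<close>-part,
  \<open>c\<close> drops out; this is what lets one rotation speed serve both forms.\<close>

lemma quad_derD: "quad c (derD x) y = snd (heis_bracket x y)"
  by (simp add: quad_def derD_def heis_bracket_def inner_complex_def)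

lemma has_derivative_quad_diag:
  "((\<lambda>z. quad c z z) has_derivative (\<lambda>v. 2 * quad c y v)) (at y)"
  using bounded_bilinear.FDERIV[OF bounded_bilinear_quad has_derivative_ident has_derivative_ident, of c y UNIV]
  by (simp add: quad_commute)

lemma has_derivative_quad_left:
  "((\<lambda>z. quad c z v) has_derivative (\<lambda>u. quad c u v)) (at y)"
  using bounded_bilinear.FDERIV[OF bounded_bilinear_quad has_derivative_ident has_derivative_const, of c v y UNIV]
  by (simp add: bounded_bilinear.zero_right[OF bounded_bilinear_quad])

section \<open>The Minkowski norm \<open>F\<close> and the derivatives of its energy\<close>

locale two_metrics =
  fixes a b :: real
  assumes a_pos: "a > 0" and b_pos: "b > 0"
begin

definition P :: "heis \<Rightarrow> real" where
  "P y = (quad a y y)\<^sup>2 + (quad b y y)\<^sup>2"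

definition dP :: "heis \<Rightarrow> heis \<Rightarrow> real" where
  "dP y v = 4 * (quad a y y * quad a y v + quad b y y * quad b y v)"

definition ddP :: "heis \<Rightarrow> heis \<Rightarrow> heis \<Rightarrow> real" where
  "ddP y u v = 8 * (quad a y u * quad a y v + quad b y u * quad b y v)
     + 4 * (quad a y y * quad a u v + quad b y y * quad b u v)"

definition F :: "heis \<Rightarrow> real" where
  "F y = sqrt (sqrt (P y))"

text \<open>\<open>H\<close> stands for \<open>(F y)^2 / 2 = sqrt (P y) / 2\<close>. The closed
  formulas for its first two derivatives take the base point first and the directions after
  it.\<close>

definition dH :: "heis \<Rightarrow> heis \<Rightarrow> real" where
  "dH y v = dP y v / (4 * sqrt (P y))"

definition ddH :: "heis \<Rightarrow> heis \<Rightarrow> heis \<Rightarrow> real" where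
  "ddH y u v = ddP y u v / (4 * sqrt (P y)) - dP y u * dP y v / (8 * P y * sqrt (P y))"

lemma P_pos: "y \<noteq> 0 \<Longrightarrow> P y > 0"
  using quad_pos[OF a_pos, of y] by (simp add: P_def add_pos_nonneg)

lemma P_nonneg: "P y \<ge> 0"
  by (simp add: P_def)

lemma F_square: "(F y)\<^sup>2 / 2 = sqrt (P y) / 2"
  by (simp add: F_def P_nonneg)

lemma has_derivative_P: "(P has_derivative dP y) (at y)"
proof -
  have "((\<lambda>y. (quad a y y)\<^sup>2 + (quad b y y)\<^sup>2) has_derivative dP y) (at y)"
    by (auto intro!: derivative_eq_intros has_derivative_quad_diag simp: dP_def fun_eq_iff algebra_simps)
  then show ?thesis by (simp add: P_def[abs_def])
qed

lemma has_derivative_dP: "((\<lambda>z. dP z v) has_derivative (\<lambda>u. ddP y u v)) (at y)"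
  unfolding dP_def ddP_def
  by (auto intro!: derivative_eq_intros has_derivative_quad_diag has_derivative_quad_left
      simp: fun_eq_iff algebra_simps)

lemma has_derivative_H:
  assumes "y \<noteq> 0"
  shows "((\<lambda>z. (F z)\<^sup>2 / 2) has_derivative dH y) (at y)"
proof -
  have "((\<lambda>z. sqrt (P z) / 2) has_derivative (\<lambda>v. dP y v / (2 * sqrt (P y)) / 2)) (at y)"
    by (intro bounded_linear.has_derivative[OF bounded_linear_divide] has_derivative_sqrt has_derivative_P P_pos assms)
  then show ?thesis
    by (simp add: F_square dH_def[abs_def])
qed

lemma has_derivative_dH:
  assumes "y \<noteq> 0"
  shows "((\<lambda>z. dH z v) has_derivative (\<lambda>u. ddH y u v)) (at y)"
proof -
  have "((\<lambda>z. dP z v / (2 * sqrt (P z)) / 2) has_derivative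
    (\<lambda>u. (ddP y u v / (2 * sqrt (P y)) - dP y u * dP y v / (4 * P y * sqrt (P y))) / 2)) (at y)"
    by (intro bounded_linear.has_derivative[OF bounded_linear_divide] has_derivative_sqrt_derivative has_derivative_P
        has_derivative_dP P_pos assms)
  then show ?thesis
    by (simp add: dH_def ddH_def diff_divide_distrib mult.assoc)
qed

lemma hess_H: "y \<noteq> 0 \<Longrightarrow> hess (\<lambda>z. (F z)\<^sup>2 / 2) y u v = ddH y u v"
  by (rule hess_eqI[of "- {0}"]) (auto intro: has_derivative_H has_derivative_dH)

text \<open>Positivity of the Hessian of \<open>sqrt P\<close> amounts to
  \<open>dP^2 < 2 * P * ddP\<close>. Cauchy-Schwarz for the plane vectors \<open>(p, q)\<close> and
  \<open>(r, s)\<close> bounds the left side by \<open>16 * P * (r^2 + s^2)\<close>, and the right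
  side exceeds this by \<open>8 * P * (p * V + q * W) > 0\<close>.\<close>

lemma ddH_pos:
  assumes "y \<noteq> 0" "v \<noteq> 0"
  shows "ddH y v v > 0"
proof -
  define p q where pq: "p = quad a y y" "q = quad b y y"
  define r s where rs: "r = quad a y v" "s = quad b y v"
  define V W where VW: "V = quad a v v" "W = quad b v v"
  have pos: "p > 0" "q > 0" "V > 0" "W > 0"
    using assms a_pos b_pos by (simp_all add: pq VW quad_pos)
  have "(p * r + q * s)\<^sup>2 \<le> (p\<^sup>2 + q\<^sup>2) * (r\<^sup>2 + s\<^sup>2)"
    using zero_le_power2[of "p * s - q * r"] by (simp add: power2_eq_square algebra_simps)
  moreover have "(p\<^sup>2 + q\<^sup>2) * (p * V + q * W) > 0"
    using pos by (simp add: add_pos_pos)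
  ultimately have "dP y v * dP y v < 2 * P y * ddP y v v"
    by (simp add: P_def dP_def ddP_def pq[symmetric] rs[symmetric] VW[symmetric]
        power2_eq_square algebra_simps)
  moreover have "ddH y v v = (2 * P y * ddP y v v - dP y v * dP y v) / (8 * P y * sqrt (P y))"
    using P_pos[OF assms(1)] by (simp add: ddH_def field_simps)
  ultimately show ?thesis using P_pos[OF assms(1)] by simp
qed

text \<open>This is the function \<kappa> of the geodesic equation: \<open>snd y\<close> times the
  mean of \<open>a\<close> and \<open>b\<close> with weights \<open>quad a y y\<close> and
  \<open>quad b y y\<close>. For \<open>a = b\<close> it is linear in \<open>y\<close>.\<close>

definition rot_speed :: "heis \<Rightarrow> real" where
  "rot_speed y = snd y * (a * quad a y y + b * quad b y y) / (quad a y y + quad b y y)"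

text \<open>Both forms make \<open>derD y\<close> orthogonal to \<open>y\<close>, so all terms of
  \<open>ddH\<close> containing \<open>quad c y (derD y)\<close> vanish. By \<open>quad_derD\<close>
  the remaining ones are multiples of the bracket, and \<open>rot_speed\<close> is the factor that
  matches them with \<open>dH y E3\<close>.\<close>

lemma ddH_derD:
  assumes "y \<noteq> 0"
  shows "ddH y (rot_speed y *\<^sub>R derD y) v = dH y E3 * snd (heis_bracket y v)"
proof -
  have z: "quad c y (derD y) = 0" for c
    by (simp add: quad_def derD_def inner_complex_def)
  have e: "quad c y E3 = c * snd y" for c
    by (simp add: quad_def E3_def)
  have pos: "quad a y y + quad b y y > 0"
    using assms a_pos b_pos by (simp add: quad_pos add_pos_pos)
  have "ddH y (rot_speed y *\<^sub>R derD y) v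
      = rot_speed y * (quad a y y + quad b y y) * snd (heis_bracket y v) / sqrt (P y)"
    by (simp add: ddH_def dP_def ddP_def quad_simps z quad_derD algebra_simps add_divide_distrib)
  also have "rot_speed y * (quad a y y + quad b y y) = snd y * (a * quad a y y + b * quad b y y)"
    using pos by (simp add: rot_speed_def)
  also have "\<dots> * snd (heis_bracket y v) / sqrt (P y) = dH y E3 * snd (heis_bracket y v)"
    by (simp add: dH_def dP_def e algebra_simps add_divide_distrib)
  finally show ?thesis .
qed

lemma ddH_diff: "ddH y (u - u') v = ddH y u v - ddH y u' v"
  by (simp add: ddH_def ddP_def dP_def quad_simps algebra_simps diff_divide_distrib add_divide_distrib)

text \<open>The difference of two solutions \<open>u\<close>, tested against itself, has zero
  Hessian value, so it vanishes by positive definiteness.\<close>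

lemma ddH_eq_iff:
  assumes "y \<noteq> 0"
  shows "(\<forall>v. ddH y u v = dH y E3 * snd (heis_bracket y v)) \<longleftrightarrow> u = rot_speed y *\<^sub>R derD y"
proof
  assume "\<forall>v. ddH y u v = dH y E3 * snd (heis_bracket y v)"
  then have "ddH y (u - rot_speed y *\<^sub>R derD y) (u - rot_speed y *\<^sub>R derD y) = 0"
    unfolding ddH_diff[of y u] by (simp only: ddH_derD[OF assms])
  then show "u = rot_speed y *\<^sub>R derD y"
    using ddH_pos[OF assms, of "u - rot_speed y *\<^sub>R derD y"] by force
qed (simp add: ddH_derD[OF assms])

lemma F_rot: "u \<in> SO2 \<Longrightarrow> F (rot u y) = F y"
  by (simp add: F_def P_def quad_rot)

lemma Ck_on_P: "Ck_on k (- {0}) P"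
proof -
  have "Ck_on k (- {0}) (\<lambda>y. quad a y y * quad a y y + quad b y y * quad b y y)"
    by (intro Ck_on_add Ck_on_mult Ck_on_bilinear[OF bounded_bilinear_quad] Ck_on_id) auto
  then show ?thesis by (simp add: P_def[abs_def] power2_eq_square)
qed

lemma smooth_on_F: "smooth_on (UNIV - {0}) F"
  unfolding smooth_on_def
proof
  fix k
  have "Ck_on k (- {0}) (\<lambda>y. P y powr (1/4))"
    by (intro Ck_on_powr Ck_on_P P_pos) auto
  moreover have "P y powr (1/4) = F y" for y
    by (simp add: F_def powr_half_sqrt[symmetric] P_nonneg powr_powr)
  ultimately show "Ck_on k (UNIV - {0}) F"
    by (simp add: Compl_eq_Diff_UNIV)
qed

lemma invariant_finsler_F: "invariant_finsler F"
proof -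
  have "quad c (r *\<^sub>R y) (r *\<^sub>R y) = r\<^sup>2 * quad c y y" for c r y
    by (simp add: quad_simps power2_eq_square)
  then have "P (r *\<^sub>R y) = r ^ 4 * P y" for r y
    by (simp add: P_def power_mult_distrib algebra_simps)
  moreover have "sqrt (r ^ 4) = r\<^sup>2" for r :: real
    by (rule real_sqrt_unique) simp_all
  ultimately have "F (r *\<^sub>R y) = r * F y" if "r > 0" for r y
    using that by (simp add: F_def real_sqrt_mult)
  moreover have "F y > 0" if "y \<noteq> 0" for y
    using P_pos[OF that] by (simp add: F_def)
  ultimately show ?thesis
    by (simp add: invariant_finsler_def minkowski_norm_def smooth_on_F hess_H ddH_pos F_rot)
qed

lemma alpha12_metric_F: "alpha12_metric F"
proof -
  \<comment> \<open>\<open>R\<close> is \<open>P\<close> as a polynomial in the values of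
    \<open>alpha1\<close> and \<open>alpha2\<close>. For \<open>a = b\<close> it vanishes on a whole
    line, so the neighbourhood of the quadrant is taken to be the set where \<open>R\<close> is
    positive.\<close>
  define R :: "real \<times> real \<Rightarrow> real" where
    "R = (\<lambda>p. (fst p + a * snd p) * (fst p + a * snd p) + (fst p + b * snd p) * (fst p + b * snd p))"
  define U where "U = {p. R p > 0}"
  have "open U"
    unfolding U_def R_def by (intro open_Collect_less continuous_intros)
  have "smooth_on U (\<lambda>p. R p powr (1/4))"
    unfolding smooth_on_def
  proof
    fix k
    have "Ck_on k U R"
      unfolding R_def
      by (intro Ck_on_add Ck_on_mult Ck_on_linear[OF bounded_linear_fst]
          Ck_on_linear[OF bounded_linear_snd] Ck_on_const Ck_on_id \<open>open U\<close>)
    then show "Ck_on k U (\<lambda>p. R p powr (1/4))"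
      using \<open>open U\<close> by (intro Ck_on_powr) (auto simp: U_def)
  qed
  moreover have "quadrant - {0} \<subseteq> U"
  proof
    fix p :: "real \<times> real" assume p: "p \<in> quadrant - {0}"
    then have "fst p + a * snd p > 0"
      using a_pos by (cases p) (auto simp: quadrant_def zero_prod_def intro: add_pos_nonneg add_nonneg_pos)
    then show "p \<in> U" by (simp add: U_def R_def add_pos_nonneg)
  qed
  ultimately have "smooth_on_quadrant (\<lambda>p. R p powr (1/4))"
    unfolding smooth_on_quadrant_def using \<open>open U\<close> by blast
  moreover have "F y = R (alpha1 y y, alpha2 y y) powr (1/4)" for y
  proof -
    have "R (alpha1 y y, alpha2 y y) = P y"
      by (simp add: R_def P_def quad_eq_alpha power2_eq_square)
    then show ?thesis by (simp add: F_def powr_half_sqrt[symmetric] P_nonneg powr_powr)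
  qed
  ultimately show ?thesis
    unfolding alpha12_metric_def using invariant_finsler_F by blast
qed

end

section \<open>Admissibility of \<open>L\<close>\<close>

lemma admissible_sqrt_quartic: "admissible (\<lambda>p. sqrt (fst p ^ 4 + snd p ^ 4))"
proof -
  define R :: "real \<times> real \<Rightarrow> real" where "R = (\<lambda>p. fst p ^ 4 + snd p ^ 4)"
  define R' :: "real \<times> real \<Rightarrow> real \<times> real \<Rightarrow> real" where
    "R' = (\<lambda>p v. 4 * (fst p ^ 3 * fst v + snd p ^ 3 * snd v))"
  define R'' :: "real \<times> real \<Rightarrow> real \<times> real \<Rightarrow> real \<times> real \<Rightarrow> real" where
    "R'' = (\<lambda>p v u. 12 * (fst p ^ 2 * fst u * fst v + snd p ^ 2 * snd u * snd v))"
  have pos: "R p > 0" if "p \<noteq> 0" for p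
    using that by (cases p) (auto simp: R_def zero_prod_def add_pos_nonneg add_nonneg_pos)
  have dR: "(R has_derivative R' p) (at p)" for p
    unfolding R_def R'_def by (auto intro!: derivative_eq_intros simp: fun_eq_iff)
  have dR': "((\<lambda>p. R' p v) has_derivative R'' p v) (at p)" for p v
    unfolding R'_def R''_def
    by (auto intro!: derivative_eq_intros simp: fun_eq_iff algebra_simps)
  have dL: "((\<lambda>p. sqrt (R p)) has_derivative (\<lambda>v. R' p v / (2 * sqrt (R p)))) (at p)" if "p \<noteq> 0" for p
    by (intro has_derivative_sqrt dR pos that)
  have hL: "hess (\<lambda>p. sqrt (R p)) p v v \<ge> 0" if "p \<noteq> 0" for p v
  proof -
    have "hess (\<lambda>p. sqrt (R p)) p v v =
        R'' p v v / (2 * sqrt (R p)) - R' p v * R' p v / (4 * R p * sqrt (R p))"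
      by (rule hess_eqI[of "- {0}"])
         (use that in \<open>auto intro: dL has_derivative_sqrt_derivative dR dR' pos\<close>)
    also have "\<dots> = (2 * R p * R'' p v v - (R' p v)\<^sup>2) / (4 * R p * sqrt (R p))"
      using pos[OF that] by (simp add: field_simps power2_eq_square)
    also have "\<dots> \<ge> 0"
    proof -
      obtain x y s t where [simp]: "p = (x, y)" "v = (s, t)" by (cases p; cases v)
      \<comment> \<open>Lagrange's identity for the vectors \<open>(x^2, y^2)\<close> and
        \<open>(x * s, y * t)\<close> accounts for two thirds of the first term; the remaining third
        is the second summand.\<close>
      have "2 * R p * R'' p v v - (R' p v)\<^sup>2
        = 16 * (x\<^sup>2 * (y * t) - y\<^sup>2 * (x * s))\<^sup>2 + 8 * (x ^ 4 + y ^ 4) * ((x * s)\<^sup>2 + (y * t)\<^sup>2)"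
        by (simp add: R_def R'_def R''_def) algebra
      also have "\<dots> \<ge> 0" by simp
      finally show ?thesis using pos[OF that] by simp
    qed
    finally show ?thesis .
  qed
  have smooth: "smooth_on (- {0}) (\<lambda>p. sqrt (R p))"
    unfolding smooth_on_def
  proof
    fix k
    have "Ck_on k (- {0}) (\<lambda>p::real\<times>real. fst p * fst p * (fst p * fst p) + snd p * snd p * (snd p * snd p))"
      by (intro Ck_on_add Ck_on_mult Ck_on_linear[OF bounded_linear_fst]
          Ck_on_linear[OF bounded_linear_snd] Ck_on_id) auto
    then have "Ck_on k (- {0}) R" by (simp add: R_def power4_eq_xxxx mult.assoc)
    then have "Ck_on k (- {0}) (\<lambda>p. R p powr (1/2))"
      by (intro Ck_on_powr pos) auto
    then show "Ck_on k (- {0}) (\<lambda>p. sqrt (R p))"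
      by (rule Ck_on_cong[rotated]) (auto simp: powr_half_sqrt less_imp_le[OF pos])
  qed
  have "sqrt (R (r *\<^sub>R p)) = r\<^sup>2 * sqrt (R p)" if "r > 0" for r p
  proof -
    have "R (r *\<^sub>R p) = r ^ 4 * R p" by (simp add: R_def algebra_simps power_mult_distrib)
    moreover have "sqrt (r ^ 4) = r\<^sup>2"
      by (rule real_sqrt_unique) simp_all
    ultimately show ?thesis by (simp add: real_sqrt_mult)
  qed
  moreover have "smooth_on_quadrant (\<lambda>p. sqrt (R p))"
    unfolding smooth_on_quadrant_def by (rule exI[of _ "- {0}"]) (auto simp: smooth)
  moreover have "continuous_on quadrant (\<lambda>p. sqrt (R p))"
    unfolding R_def by (intro continuous_intros)
  moreover have "R' p (1, 0) \<ge> 0 \<and> R' p (0, 1) \<ge> 0 \<and> R' p (1, 0) + R' p (0, 1) > 0"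
    if "p \<in> quadrant - {0}" for p
    using that by (cases p) (auto simp: R'_def quadrant_def zero_prod_def add_pos_nonneg add_nonneg_pos)
  ultimately have "admissible (\<lambda>p. sqrt (R p))"
    unfolding admissible_def
    by (auto simp: pos hL frechet_derivative_at[OF dL, symmetric] add_divide_distrib[symmetric]
        intro!: divide_nonneg_pos)
  then show ?thesis by (simp add: R_def)
qed

subsection \<open>One-parameter subgroups\<close>

lemma bounded_bilinear_heis_bracket: "bounded_bilinear heis_bracket"
proof -
  have "bilinear heis_bracket"
    unfolding bilinear_def
    by (auto intro!: linearI simp: heis_bracket_def prod_eq_iff algebra_simps)
  then show ?thesis by (rule bilinear_conv_bounded_bilinear[THEN iffD1])
qed

lemma heis_bracket_self: "heis_bracket x x = 0"
  by (simp add: heis_bracket_def zero_prod_def)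

lemma fst_heis_bracket [simp]: "fst (heis_bracket x y) = 0"
  by (simp add: heis_bracket_def)

lemma cis_SO2: "cis t \<in> SO2"
  by (simp add: SO2_def)

lemma has_vector_derivative_cis:
  "((\<lambda>t. cis (k * t)) has_vector_derivative \<i> * (k * cis (k * t))) (at t within S)"
  unfolding has_vector_derivative_def
  by (auto intro!: derivative_eq_intros simp: scaleR_conv_of_real)

lemma heis_mult_rot_0: "heis_mult p (rot u 0) = p"
  by (simp add: heis_mult_def rot_def heis_bracket_def zero_prod_def[symmetric])

lemma interval_constant:
  fixes f :: "real \<Rightarrow> 'a::banach"
  assumes "is_interval I" "0 \<in> I" "t \<in> I"
    and f: "\<And>t. t \<in> I \<Longrightarrow> (f has_vector_derivative 0) (at t within I)"
  shows "f t = f 0"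
proof -
  obtain d where "\<And>t. t \<in> I \<Longrightarrow> f t = d"
    using has_vector_derivative_zero_constant[OF is_interval_convex[OF assms(1)] f] by blast
  with assms(2,3) show ?thesis by simp
qed

text \<open>Multiplication by the integrating factor \<open>cis (- k * t)\<close> makes the solution
  constant.\<close>

lemma rotation_ode:
  fixes u :: "real \<Rightarrow> complex"
  assumes "is_interval I" "0 \<in> I" "t \<in> I"
    "\<And>t. t \<in> I \<Longrightarrow> (u has_vector_derivative \<i> * (k * u t)) (at t within I)"
  shows "u t = cis (k * t) * u 0"
proof -
  have "((\<lambda>t. cis (- k * t) * u t) has_vector_derivative 0) (at t within I)" if "t \<in> I" for t
    by (rule has_vector_derivative_eq_rhs[OF
          has_vector_derivative_mult[OF has_vector_derivative_cis assms(4)[OF that]]])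
       (simp add: algebra_simps)
  then have "cis (- k * t) * u t = cis (- k * 0) * u 0"
    by (rule interval_constant[OF assms(1-3)])
  then have "cis (- k * t) * u t = u 0"
    by simp
  then have "cis (k * t) * u 0 = cis (k * t) * cis (- k * t) * u t"
    by (simp only: mult.assoc)
  then show ?thesis by (simp add: cis_mult)
qed

text \<open>Left translation by \<open>x\<close> sends \<open>q\<close> to
  \<open>x + q + [x, q] / 2\<close>, so its differential at the origin maps \<xi> to the right-hand
  side. The equation says that the velocity of the curve is the left translate of \<xi>.\<close>

definition has_body_velocity :: "(real \<Rightarrow> heis) \<Rightarrow> (real \<Rightarrow> heis) \<Rightarrow> real \<Rightarrow> bool" where
  "has_body_velocity x \<xi> t \<longleftrightarrow> (x has_vector_derivative (\<xi> t + (1/2) *\<^sub>R heis_bracket (x t) (\<xi> t))) (at t)"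

text \<open>The equation is triangular: the bracket only sees the horizontal component of the curve,
  and that component has derivative \<open>fst (\<xi> t)\<close>. Hence horizontal components agree
  first, then the brackets agree, and a second integration gives the rest.\<close>

lemma has_body_velocity_unique:
  assumes "is_interval I" "0 \<in> I" "t \<in> I" "x 0 = y 0"
    and x: "\<And>t. t \<in> I \<Longrightarrow> has_body_velocity x \<xi> t"
    and y: "\<And>t. t \<in> I \<Longrightarrow> has_body_velocity y \<xi> t"
  shows "x t = y t"
proof -
  have D: "((\<lambda>t. x t - y t) has_vector_derivative
      ((1/2) *\<^sub>R heis_bracket (x t) (\<xi> t) - (1/2) *\<^sub>R heis_bracket (y t) (\<xi> t))) (at t)"
    if "t \<in> I" for t
    using has_vector_derivative_diff[OF x[OF that, unfolded has_body_velocity_def] y[OF that, unfolded has_body_velocity_def]]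
    by simp
  have "((\<lambda>t. fst (x t - y t)) has_vector_derivative 0) (at t within I)" if "t \<in> I" for t
    using has_vector_derivative_at_within[OF
        bounded_linear.has_vector_derivative[OF bounded_linear_fst D[OF that]]] by simp
  then have "fst (x t - y t) = fst (x 0 - y 0)" if "t \<in> I" for t
    by (rule interval_constant[OF assms(1,2) that])
  then have fst_eq: "fst (x t) = fst (y t)" if "t \<in> I" for t
    using that assms(4) by simp
  have "((\<lambda>t. x t - y t) has_vector_derivative 0) (at t within I)" if "t \<in> I" for t
    using has_vector_derivative_at_within[OF D[OF that]]
    by (simp add: heis_bracket_def fst_eq[OF that])
  then have "x t - y t = x 0 - y 0"
    by (rule interval_constant[OF assms(1-3)])
  then show ?thesis
    using assms(4) by simp
qed

text \<open>For \<open>k \<noteq> 0\<close> the element \<open>X + k D\<close> is conjugate to a combination of \<open>E\<^sub>3\<close> and \<open>D\<close>,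
  so its orbit through the origin is a helix around a vertical axis.\<close>

definition orb :: "lie_g \<Rightarrow> real \<Rightarrow> heis" where
  "orb y t = (let w = fst (fst y); s = snd (fst y); k = snd y in
     if k = 0 then (t *\<^sub>R w, t * s)
     else ((\<i> * w / k) * (1 - cis (k * t)),
       (s + (norm w)\<^sup>2 / (2 * k)) * t - (norm w)\<^sup>2 / (2 * k\<^sup>2) * sin (k * t)))"

lemma orb_0 [simp]: "orb y 0 = 0"
  by (simp add: orb_def zero_prod_def Let_def)

text \<open>A one-parameter subgroup with generator \<open>X + k D\<close> has rotation part
  \<open>cis (k * t)\<close>, which carries the initial velocity \<open>X\<close> along. The
  explicit helix is checked here once; afterwards \<open>orb\<close> is handled almost only through
  this property.\<close>

lemma orb_has_body_velocity: "has_body_velocity (orb y) (\<lambda>t. rot (cis (snd y * t)) (fst y)) t"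
proof -
  obtain w s k where y: "y = ((w, s), k)" by (metis prod.exhaust)
  show ?thesis
  proof (cases "k = 0")
    case True
    have orb: "orb y = (\<lambda>t. t *\<^sub>R (w, s))" by (auto simp: orb_def y True)
    have "((\<lambda>t. t *\<^sub>R (w, s)) has_vector_derivative (w, s)) (at t)"
      using bounded_linear.has_vector_derivative[OF bounded_linear_scaleR_left[of "(w, s)"]
          has_vector_derivative_id] by (simp only: scaleR_one)
    moreover have "heis_bracket (t *\<^sub>R (w, s)) (w, s) = 0"
      by (simp add: heis_bracket_def zero_prod_def)
    moreover have "rot (cis (snd y * t)) (fst y) = (w, s)"
      by (simp add: rot_def y True)
    ultimately show ?thesis
      by (simp only: has_body_velocity_def orb) simp
  next
    case False
    have 1: "((\<lambda>t. \<i> * w / k * (1 - cis (k * t))) has_vector_derivative cis (k * t) * w) (at t)"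
      by (rule has_vector_derivative_eq_rhs[OF has_vector_derivative_mult_right[OF
            has_vector_derivative_diff[OF has_vector_derivative_const has_vector_derivative_cis]]])
         (simp add: False algebra_simps)
    have 2: "((\<lambda>t. (s + (norm w)\<^sup>2 / (2 * k)) * t - (norm w)\<^sup>2 / (2 * k\<^sup>2) * sin (k * t))
       has_vector_derivative (s + (norm w)\<^sup>2 / (2 * k)) - (norm w)\<^sup>2 / (2 * k) * cos (k * t)) (at t)"
      unfolding has_real_derivative_iff_has_vector_derivative[symmetric]
      by (auto intro!: derivative_eq_intros simp: False field_simps power2_eq_square)
    have "snd (heis_bracket (\<i> * w / k * (1 - cis (k * t)), h) (cis (k * t) * w, s))
        = (norm w)\<^sup>2 / k * (1 - cos (k * t))" for h
    proof -
      have eq: "\<i> * w / k * (1 - cis (k * t)) = (1 / k) *\<^sub>R (\<i> * w * (1 - cis (k * t)))"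
        by (simp add: scaleR_conv_of_real field_simps)
      \<comment> \<open>The sum of squares of \<open>cos\<close> and \<open>sin\<close> is kept
        unreduced, so that this is a polynomial identity in real and imaginary parts; it is replaced
        by 1 only afterwards.\<close>
      have "Re (\<i> * w * (1 - cis \<theta>)) * Im (cis \<theta> * w) - Im (\<i> * w * (1 - cis \<theta>)) * Re (cis \<theta> * w)
         = (Re w * Re w + Im w * Im w) * (cos \<theta> * cos \<theta> + sin \<theta> * sin \<theta> - cos \<theta>)" for \<theta>
        by (simp add: algebra_simps del: sin_cos_squared_add3)
      moreover have "(norm w)\<^sup>2 = Re w * Re w + Im w * Im w"
        by (simp add: cmod_def power2_eq_square)
      ultimately have "snd (heis_bracket (\<i> * w * (1 - cis (k * t)), h) (cis (k * t) * w, s))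
         = (norm w)\<^sup>2 * (1 - cos (k * t))"
        unfolding heis_bracket_def fst_conv snd_conv sin_cos_squared_add3
        by simp
      moreover have "snd (heis_bracket (r *\<^sub>R z, h) x) = r * snd (heis_bracket (z, h) x)" for r z x
        by (simp add: heis_bracket_def algebra_simps)
      ultimately show ?thesis
        unfolding eq by simp
    qed
    then have eq: "(cis (k * t) * w, s + (norm w)\<^sup>2 / (2 * k) - (norm w)\<^sup>2 / (2 * k) * cos (k * t))
        = rot (cis (k * t)) (w, s) + (1/2) *\<^sub>R
          heis_bracket (\<i> * w / k * (1 - cis (k * t)), h) (rot (cis (k * t)) (w, s))" for h
      using False by (simp add: prod_eq_iff rot_def) (simp add: field_simps)
    have orb: "orb y = (\<lambda>t. (\<i> * w / k * (1 - cis (k * t)),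
       (s + (norm w)\<^sup>2 / (2 * k)) * t - (norm w)\<^sup>2 / (2 * k\<^sup>2) * sin (k * t)))"
      by (simp add: orb_def y False fun_eq_iff)
    have "(orb y has_vector_derivative rot (cis (k * t)) (w, s) +
        (1/2) *\<^sub>R heis_bracket (orb y t) (rot (cis (k * t)) (w, s))) (at t)"
      unfolding orb by (rule has_vector_derivative_eq_rhs[OF has_vector_derivative_Pair[OF 1 2] eq])
    then show ?thesis by (simp only: has_body_velocity_def y fst_conv snd_conv)
  qed
qed

text \<open>The curve is moved by the element \<open>(p, u)\<close> of the group: left translation
  preserves body velocities, and the automorphism \<open>rot u\<close> transforms them by its
  differential, again \<open>rot u\<close>.\<close>

lemma has_body_velocity_left_translate:
  assumes "has_body_velocity x \<xi> t" "u \<in> SO2"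
  shows "has_body_velocity (\<lambda>t. heis_mult p (rot u (x t))) (\<lambda>t. rot u (\<xi> t)) t"
proof -
  \<comment> \<open>The action of \<open>(p, u)\<close> is the affine map
    \<open>x \<mapsto> p + l x\<close>.\<close>
  define l where "l x = rot u x + (1/2) *\<^sub>R heis_bracket p (rot u x)" for x
  have "linear l"
    by (rule linearI) (simp_all add: l_def rot_def heis_bracket_def prod_eq_iff algebra_simps)
  then have "bounded_linear l" by (simp add: linear_conv_bounded_linear)
  from bounded_linear.has_vector_derivative[OF this assms(1)[unfolded has_body_velocity_def]]
  have "((\<lambda>t. p + l (x t)) has_vector_derivative l (\<xi> t + (1/2) *\<^sub>R heis_bracket (x t) (\<xi> t))) (at t)"
    by (auto intro!: derivative_eq_intros)
  moreover have "l (\<xi> t + (1/2) *\<^sub>R heis_bracket (x t) (\<xi> t))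
    = rot u (\<xi> t) + (1/2) *\<^sub>R heis_bracket (heis_mult p (rot u (x t))) (rot u (\<xi> t))"
  proof -
    have "l (z + (1/2) *\<^sub>R heis_bracket y z)
      = rot u z + (1/2) *\<^sub>R (heis_bracket p (rot u z) + heis_bracket (rot u y) (rot u z))" for y z
      unfolding heis_bracket_rot[OF assms(2)]
      by (simp add: l_def rot_def heis_bracket_def prod_eq_iff algebra_simps)
    also have "heis_bracket p (rot u z) + heis_bracket (rot u y) (rot u z)
      = heis_bracket (heis_mult p (rot u y)) (rot u z)" for y z
      by (simp add: heis_mult_def heis_bracket_def prod_eq_iff algebra_simps)
    finally show ?thesis .
  qed
  ultimately show ?thesis
    by (simp add: has_body_velocity_def heis_mult_def l_def algebra_simps)
qed

lemma has_vector_derivative_shift: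
  "((\<lambda>t. f (s + t)) has_vector_derivative d) (at t) \<longleftrightarrow> (f has_vector_derivative d) (at (s + t))"
proof -
  have shift: "((\<lambda>t. f (r + t)) has_vector_derivative d) (at t)"
    if "(f has_vector_derivative d) (at (r + t))" for f r t
  proof -
    have "((\<lambda>t. r + t) has_vector_derivative 1) (at t)"
      by (auto intro!: derivative_eq_intros)
    from vector_diff_chain_at[OF this that] show ?thesis by (simp add: o_def)
  qed
  show ?thesis
    using shift[of f s t] shift[of "\<lambda>t. f (s + t)" "- s" "s + t"] by (simp add: iffI)
qed

lemma has_body_velocity_shift: "has_body_velocity (\<lambda>t. x (s + t)) (\<lambda>t. \<xi> (s + t)) t \<longleftrightarrow> has_body_velocity x \<xi> (s + t)"
  by (simp add: has_body_velocity_def has_vector_derivative_shift)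

lemma rot_rot: "rot u (rot v x) = rot (u * v) x"
  by (simp add: rot_def mult.assoc)

text \<open>As functions of \<open>t\<close> both sides start at \<open>orb y s\<close> and have
  body velocity \<open>rot (cis (snd y * (s + t))) (fst y)\<close>, so uniqueness replaces a
  trigonometric computation.\<close>

lemma orb_add:
  "orb y (s + t) = heis_mult (orb y s) (rot (cis (snd y * s)) (orb y t))"
proof (rule has_body_velocity_unique[where I = UNIV and t = t and x = "\<lambda>t. orb y (s + t)"
      and \<xi> = "\<lambda>t. rot (cis (snd y * (s + t))) (fst y)"])
  show "has_body_velocity (\<lambda>t. orb y (s + t)) (\<lambda>t. rot (cis (snd y * (s + t))) (fst y)) t" for t
    using has_body_velocity_shift[of "orb y" s "\<lambda>t. rot (cis (snd y * t)) (fst y)"] orb_has_body_velocity by simp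
  show "has_body_velocity (\<lambda>t. heis_mult (orb y s) (rot (cis (snd y * s)) (orb y t)))
      (\<lambda>t. rot (cis (snd y * (s + t))) (fst y)) t" for t
    using has_body_velocity_left_translate[OF orb_has_body_velocity cis_SO2, of "orb y s" "snd y * s" y]
    by (simp add: rot_rot cis_mult algebra_simps)
qed (simp_all add: heis_mult_rot_0)

lemma one_param_subgroup_orb:
  "one_param_subgroup y (\<lambda>t. (orb y t, cis (snd y * t)))"
proof -
  have "(orb y has_vector_derivative fst y) (at 0)"
    using orb_has_body_velocity[of y 0]
    by (simp add: has_body_velocity_def rot_def heis_bracket_def zero_prod_def[symmetric])
  then have "((\<lambda>t. (orb y t, cis (snd y * t))) has_vector_derivative (fst y, snd y * \<i>)) (at 0)"
    using has_vector_derivative_Pair has_vector_derivative_cis[of "snd y" 0 UNIV]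
    by (fastforce simp: mult.commute)
  then show ?thesis
    by (auto simp: one_param_subgroup_def G_set_def cis_SO2 G_mult_def orb_add cis_mult algebra_simps)
qed

text \<open>The homomorphism law spreads the derivative at 0 to every time. The circle component
  then solves the rotation equation, and the Heisenberg component has the body velocity that
  determines \<open>orb y\<close>.\<close>

lemma one_param_subgroup_unique:
  assumes "one_param_subgroup y \<gamma>"
  shows "\<gamma> t = (orb y t, cis (snd y * t))"
proof -
  define x where "x = (\<lambda>t. fst (\<gamma> t))"
  define u where "u = (\<lambda>t. snd (\<gamma> t))"
  have u: "u t \<in> SO2" for t
  proof -
    have "\<gamma> t \<in> G_set"
      using assms unfolding one_param_subgroup_def by blast
    then show ?thesis by (auto simp: G_set_def u_def)
  qed
  have "\<gamma> (s + t) = G_mult (\<gamma> s) (\<gamma> t)" for s t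
    using assms unfolding one_param_subgroup_def by blast
  then have x_add: "x (s + t) = heis_mult (x s) (rot (u s) (x t))"
    and u_add: "u (s + t) = u s * u t" for s t
    by (simp_all add: G_mult_def x_def u_def)
  have "u 0 = u 0 * u 0"
    using u_add[of 0 0] by (simp only: add_0)
  moreover have "u 0 \<noteq> 0" using u[of 0] by (auto simp: SO2_def)
  ultimately have u0: "u 0 = 1" by simp
  have "heis_mult z (rot 1 z) = z + z" for z
    by (simp add: rot_def heis_mult_def heis_bracket_self)
  with x_add[of 0 0] have "x 0 = x 0 + x 0"
    by (simp only: u0 add_0)
  then have x0: "x 0 = 0" by simp
  have d: "(\<gamma> has_vector_derivative (fst y, complex_of_real (snd y) * \<i>)) (at 0)"
    using assms by (simp add: one_param_subgroup_def)
  have du0: "(u has_vector_derivative \<i> * snd y) (at 0)"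
    using bounded_linear.has_vector_derivative[OF bounded_linear_snd d]
    unfolding u_def by (simp add: mult.commute)
  have du: "(u has_vector_derivative \<i> * (snd y * u s)) (at s)" for s
  proof (rule has_vector_derivative_shift[of u s _ 0, simplified, THEN iffD1])
    show "((\<lambda>t. u (s + t)) has_vector_derivative \<i> * (snd y * u s)) (at 0)"
      unfolding u_add using has_vector_derivative_mult_right[OF du0, of "u s"]
      by (simp add: mult_ac)
  qed
  have ut: "u t = cis (snd y * t)" for t
    using rotation_ode[of UNIV t u "snd y", OF _ _ _ du] by (simp add: u0)
  have "has_body_velocity x (\<lambda>t. fst y) 0"
  proof -
    have "(x has_vector_derivative fst y) (at 0)"
      using bounded_linear.has_vector_derivative[OF bounded_linear_fst d] unfolding x_def by simp
    moreover have "heis_bracket (x 0) z = 0" for z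
      by (simp add: x0 heis_bracket_def zero_prod_def)
    ultimately show ?thesis
      unfolding has_body_velocity_def by simp
  qed
  then have "has_body_velocity (\<lambda>t. heis_mult (x s) (rot (u s) (x t))) (\<lambda>t. rot (u s) (fst y)) 0" for s
    by (rule has_body_velocity_left_translate) (rule u)
  then have "has_body_velocity x (\<lambda>t. rot (cis (snd y * t)) (fst y)) s" for s
    unfolding has_body_velocity_def x_add[symmetric] ut[symmetric] add_0_right
    by (rule has_vector_derivative_shift[of x s _ 0, simplified, THEN iffD1])
  then have "x t = orb y t"
    by (rule has_body_velocity_unique[OF is_interval_univ, rotated 3]) (simp_all add: x0 orb_has_body_velocity)
  then show ?thesis
    using ut[of t] unfolding x_def u_def by (simp add: prod_eq_iff)
qed

text \<open>The reparametrized subgroup gives existence and \<open>one_param_subgroup_unique\<close>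
  gives uniqueness, so the definite description in \<open>lie_exp\<close> denotes.\<close>

lemma lie_exp_scaleR: "lie_exp (t *\<^sub>R y) = (orb y t, cis (snd y * t))"
proof -
  have "one_param_subgroup (t *\<^sub>R y) (\<lambda>s. (orb y (s * t), cis (snd y * (s * t))))"
  proof -
    have y: "one_param_subgroup y (\<lambda>t. (orb y t, cis (snd y * t)))"
      by (rule one_param_subgroup_orb)
    have "((\<lambda>s. s * t) has_vector_derivative t) (at 0)"
      by (auto intro!: derivative_eq_intros)
    moreover have "((\<lambda>t. (orb y t, cis (snd y * t))) has_vector_derivative
        (fst y, complex_of_real (snd y) * \<i>)) (at (0 * t))"
      using y by (simp add: one_param_subgroup_def)
    ultimately have "((\<lambda>s. (orb y (s * t), cis (snd y * (s * t)))) has_vector_derivative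
        t *\<^sub>R (fst y, complex_of_real (snd y) * \<i>)) (at 0)"
      by (rule vector_diff_chain_at[unfolded o_def])
    then show ?thesis
      using y unfolding one_param_subgroup_def
      by (auto simp: distrib_right scaleR_conv_of_real mult.assoc)
  qed
  then have "\<exists>\<gamma>. one_param_subgroup (t *\<^sub>R y) \<gamma> \<and> (orb y t, cis (snd y * t)) = \<gamma> 1"
    by force
  \<comment> \<open>Uniqueness applied to the reparametrized subgroup gives this without comparing
    the two helix formulas.\<close>
  moreover have "orb (t *\<^sub>R y) 1 = orb y t"
    using one_param_subgroup_unique[OF \<open>one_param_subgroup (t *\<^sub>R y) _\<close>, of 1] by simp
  then have "g = (orb y t, cis (snd y * t))"
    if "one_param_subgroup (t *\<^sub>R y) \<gamma>" "g = \<gamma> 1" for g \<gamma>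
    using one_param_subgroup_unique[OF that(1), of 1] that(2) by (simp add: mult.commute)
  ultimately show ?thesis
    unfolding lie_exp_def by (intro the_equality) blast+
qed

lemma G_act_lie_exp: "G_act (lie_exp (t *\<^sub>R y)) origin = orb y t"
  by (simp add: lie_exp_scaleR G_act_def origin_def rot_def heis_mult_def heis_bracket_def zero_prod_def[symmetric])

subsection \<open>Geodesics\<close>

text \<open>The differential at \<open>x\<close> of left translation by \<open>heis_inv x\<close>,
  that is, the Maurer-Cartan form.\<close>

definition body_velocity :: "heis \<Rightarrow> heis \<Rightarrow> heis" where
  "body_velocity x v = v - (1/2) *\<^sub>R heis_bracket x v"

lemma finsler_eq_body_velocity: "finsler f x v = f (body_velocity x v)"
proof -
  have "((\<lambda>q. heis_mult (heis_inv x) q) has_derivative (body_velocity x)) (at x)"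
    unfolding heis_mult_def heis_inv_def body_velocity_def
    by (auto intro!: derivative_eq_intros bounded_bilinear.FDERIV[OF bounded_bilinear_heis_bracket]
        simp: fun_eq_iff heis_bracket_def prod_eq_iff field_simps)
  from frechet_derivative_at[OF this, symmetric] show ?thesis
    by (simp add: finsler_def)
qed

lemma fst_body_velocity [simp]: "fst (body_velocity x v) = fst v"
  by (simp add: body_velocity_def)

lemma body_velocity_eq_0_iff [simp]: "body_velocity x v = 0 \<longleftrightarrow> v = 0"
  by (auto simp: body_velocity_def heis_bracket_def prod_eq_iff)

lemma body_velocity_inverse:
  "body_velocity x (\<xi> + (1/2) *\<^sub>R heis_bracket x \<xi>) = \<xi>"
  "body_velocity x v + (1/2) *\<^sub>R heis_bracket x (body_velocity x v) = v"
  by (simp_all add: body_velocity_def heis_bracket_def prod_eq_iff)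

lemma has_body_velocity_iff:
  assumes "(x has_vector_derivative v) (at t)"
  shows "has_body_velocity x \<xi> t \<longleftrightarrow> \<xi> t = body_velocity (x t) v"
  unfolding has_body_velocity_def using assms
  by (metis body_velocity_inverse vector_derivative_unique_at)

lemma has_vector_derivative_heis_bracket:
  assumes "(x has_vector_derivative x') (at t)" "(y has_vector_derivative y') (at t)"
  shows "((\<lambda>t. heis_bracket (x t) (y t)) has_vector_derivative
    (heis_bracket (x t) y' + heis_bracket x' (y t))) (at t)"
  using bounded_bilinear.has_vector_derivative[OF bounded_bilinear_heis_bracket assms] .

text \<open>Differentiating the base point contributes only the bracket of the velocity with itself,
  which is zero.\<close>

lemma has_vector_derivative_body_velocity:
  assumes "(c has_vector_derivative v t) (at t)" "(v has_vector_derivative a) (at t)"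
  shows "((\<lambda>t. body_velocity (c t) (v t)) has_vector_derivative body_velocity (c t) a) (at t)"
  unfolding body_velocity_def
  by (rule has_vector_derivative_eq_rhs[OF has_vector_derivative_diff[OF assms(2)
        bounded_linear.has_vector_derivative[OF bounded_linear_scaleR_right
          has_vector_derivative_heis_bracket[OF assms]]]])
     (simp add: heis_bracket_self)

section \<open>The Euler-Lagrange equations in terms of the body velocity\<close>

context two_metrics
begin

lemma dH_add: "dH y (u + v) = dH y u + dH y v"
  by (simp add: dH_def dP_def quad_simps algebra_simps add_divide_distrib)

lemma dH_scaleR: "dH y (r *\<^sub>R v) = r * dH y v"
  by (simp add: dH_def dP_def quad_simps algebra_simps add_divide_distrib)

lemma dH_heis_bracket: "dH y (heis_bracket u v) = snd (heis_bracket u v) * dH y E3"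
proof -
  have "heis_bracket u v = snd (heis_bracket u v) *\<^sub>R E3"
    by (simp add: heis_bracket_def E3_def)
  then show ?thesis by (metis dH_scaleR)
qed

lemma energy_eq: "energy F x v = (F (body_velocity x v))\<^sup>2 / 2"
  by (simp add: energy_def finsler_eq_body_velocity)

lemma frechet_derivative_energy_velocity:
  assumes "v \<noteq> 0"
  shows "frechet_derivative (energy F x) (at v) w = dH (body_velocity x v) (body_velocity x w)"
proof -
  have "(body_velocity x has_derivative body_velocity x) (at v)"
    unfolding body_velocity_def
    by (auto intro!: derivative_eq_intros bounded_bilinear.FDERIV[OF bounded_bilinear_heis_bracket]
        simp: fun_eq_iff heis_bracket_def prod_eq_iff)
  from has_derivative_compose[OF this has_derivative_H] assms
  have "(energy F x has_derivative (\<lambda>w. dH (body_velocity x v) (body_velocity x w))) (at v)"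
    by (simp add: energy_eq[abs_def])
  from frechet_derivative_at[OF this, symmetric] show ?thesis by simp
qed

lemma frechet_derivative_energy_position:
  assumes "v \<noteq> 0"
  shows "frechet_derivative (\<lambda>x. energy F x v) (at x) w =
    dH (body_velocity x v) (- (1/2) *\<^sub>R heis_bracket w v)"
proof -
  have "((\<lambda>x. body_velocity x v) has_derivative (\<lambda>w. - (1/2) *\<^sub>R heis_bracket w v)) (at x)"
    unfolding body_velocity_def
    by (auto intro!: derivative_eq_intros bounded_bilinear.FDERIV[OF bounded_bilinear_heis_bracket]
        simp: fun_eq_iff heis_bracket_def prod_eq_iff)
  from has_derivative_compose[OF this has_derivative_H] assms
  have "((\<lambda>x. energy F x v) has_derivative
      (\<lambda>w. dH (body_velocity x v) (- (1/2) *\<^sub>R heis_bracket w v))) (at x)"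
    by (simp add: energy_eq[abs_def])
  from frechet_derivative_at[OF this, symmetric] show ?thesis by simp
qed

text \<open>In terms of the body velocity \<open>\<xi>\<close>, and with \<open>H = F\<^sup>2 / 2\<close>, the Euler-Lagrange equations say
  \<open>Hess H (\<xi>', w) = dH(E\<^sub>3) snd [\<xi>, w]\<close> for all \<open>w\<close>. By rotation invariance of \<open>H\<close>, \<open>\<xi>' = \<kappa>(\<xi>) D \<xi>\<close> is a solution,
  and it is the only one since the Hessian is nondegenerate.\<close>

lemma euler_lagrange_iff:
  assumes I: "open I" "t \<in> I"
    and c: "\<And>\<tau>. \<tau> \<in> I \<Longrightarrow> (c has_vector_derivative v \<tau>) (at \<tau>)"
    and v: "\<And>\<tau>. \<tau> \<in> I \<Longrightarrow> v \<tau> \<noteq> 0"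
    and acc: "(v has_vector_derivative acc) (at t)"
    and \<xi>: "\<And>\<tau>. \<xi> \<tau> = body_velocity (c \<tau>) (v \<tau>)"
  shows "(\<forall>w. ((\<lambda>\<tau>. frechet_derivative (energy F (c \<tau>)) (at (velocity c \<tau>)) w)
           has_real_derivative
         frechet_derivative (\<lambda>x. energy F x (velocity c t)) (at (c t)) w) (at t))
    \<longleftrightarrow> (\<xi> has_vector_derivative rot_speed (\<xi> t) *\<^sub>R derD (\<xi> t)) (at t)"
    (is "(\<forall>w. (?p w has_real_derivative ?q w) (at t)) \<longleftrightarrow> _")
proof -
  define \<xi>' where "\<xi>' = body_velocity (c t) acc"
  have d\<xi>: "(\<xi> has_vector_derivative \<xi>') (at t)"
    using has_vector_derivative_body_velocity[OF c[OF I(2)] acc] by (simp add: \<xi>[abs_def] \<xi>'_def)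
  have nz: "\<xi> t \<noteq> 0" using v[OF I(2)] by (simp add: \<xi>)
  have vel: "velocity c \<tau> = v \<tau>" if "\<tau> \<in> I" for \<tau>
    using c[OF that] by (simp add: velocity_def vector_derivative_at)
  define \<beta> where "\<beta> x y = snd (heis_bracket x y)" for x y
  define \<eta> where "\<eta> = dH (\<xi> t) E3"
  have p: "?p w \<tau> = dH (\<xi> \<tau>) w - (1/2) * \<beta> (c \<tau>) w * dH (\<xi> \<tau>) E3" if "\<tau> \<in> I" for w \<tau>
  proof -
    have "?p w \<tau> = dH (\<xi> \<tau>) (w + (- (1/2)) *\<^sub>R heis_bracket (c \<tau>) w)"
      using that by (simp add: vel frechet_derivative_energy_velocity v \<xi> body_velocity_def)
    then show ?thesis
      by (simp only: dH_add dH_scaleR dH_heis_bracket \<beta>_def)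
  qed
  have ddH: "((\<lambda>\<tau>. dH (\<xi> \<tau>) w) has_real_derivative ddH (\<xi> t) \<xi>' w) (at t)" for w
  proof -
    have "(\<xi> has_derivative (\<lambda>h. h *\<^sub>R \<xi>')) (at t)"
      using d\<xi> by (simp add: has_vector_derivative_def)
    from has_derivative_compose[OF this has_derivative_dH[OF nz]]
    have "((\<lambda>\<tau>. dH (\<xi> \<tau>) w) has_derivative (\<lambda>h. ddH (\<xi> t) (h *\<^sub>R \<xi>') w)) (at t)" .
    moreover have "ddH y (h *\<^sub>R u) w = ddH y u w * h" for y h u
      by (simp add: ddH_def ddP_def dP_def quad_simps algebra_simps diff_divide_distrib add_divide_distrib)
    ultimately show ?thesis by (simp add: has_field_derivative_def)
  qed
  have d\<beta>: "((\<lambda>\<tau>. \<beta> (c \<tau>) w) has_real_derivative \<beta> (v t) w) (at t)" for w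
    using bounded_linear.has_vector_derivative[OF bounded_linear_snd
        has_vector_derivative_heis_bracket[OF c[OF I(2)] has_vector_derivative_const]]
    by (simp add: \<beta>_def has_real_derivative_iff_has_vector_derivative heis_bracket_def)
  have dp: "(?p w has_real_derivative
      ddH (\<xi> t) \<xi>' w - (1/2) * (\<beta> (v t) w * \<eta> + \<beta> (c t) w * ddH (\<xi> t) \<xi>' E3)) (at t)" for w
  proof -
    have "((\<lambda>\<tau>. dH (\<xi> \<tau>) w - (1/2) * \<beta> (c \<tau>) w * dH (\<xi> \<tau>) E3) has_real_derivative
      ddH (\<xi> t) \<xi>' w - (1/2) * (\<beta> (v t) w * \<eta> + \<beta> (c t) w * ddH (\<xi> t) \<xi>' E3)) (at t)"
      by (rule derivative_eq_intros ddH d\<beta> refl)+ (simp add: \<eta>_def algebra_simps)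
    then show ?thesis
      by (rule has_field_derivative_transform_within_open[OF _ I]) (rule p[symmetric])
  qed
  have q: "?q w = (1/2) * \<beta> (v t) w * \<eta>" for w
  proof -
    have "?q w = dH (\<xi> t) ((- (1/2)) *\<^sub>R heis_bracket w (v t))"
      using I(2) by (simp add: vel frechet_derivative_energy_position v \<xi>)
    also have "\<dots> = (1/2) * \<beta> (v t) w * \<eta>"
      by (simp only: dH_scaleR dH_heis_bracket \<beta>_def \<eta>_def) (simp add: heis_bracket_def algebra_simps)
    finally show ?thesis .
  qed
  \<comment> \<open>The derivative of the momentum and the derivative in the position each
    contribute half of the term with \<eta>; on one side they add up to the coefficient 1.\<close>
  have EL: "(?p w has_real_derivative ?q w) (at t) \<longleftrightarrow>
      ddH (\<xi> t) \<xi>' w - (1/2) * \<beta> (c t) w * ddH (\<xi> t) \<xi>' E3 = \<eta> * \<beta> (v t) w" for w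
  proof -
    have "(?p w has_real_derivative ?q w) (at t) \<longleftrightarrow>
      ddH (\<xi> t) \<xi>' w - (1/2) * (\<beta> (v t) w * \<eta> + \<beta> (c t) w * ddH (\<xi> t) \<xi>' E3) = ?q w"
      using dp[of w] DERIV_unique by fastforce
    moreover have "A - (1/2) * (B * h + C * D) = (1/2) * B * h \<longleftrightarrow> A - (1/2) * C * D = h * B"
      for A B C D h :: real
      by (auto simp: field_simps)
    ultimately show ?thesis unfolding q by blast
  qed
  have E3: "\<beta> x E3 = 0" for x by (simp add: \<beta>_def heis_bracket_def E3_def)
  have \<beta>: "snd (heis_bracket (\<xi> t) w) = \<beta> (v t) w" for w
    by (simp add: \<beta>_def \<xi> heis_bracket_def)
  \<comment> \<open>The test direction \<open>E3\<close> is central, so it gives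
    \<open>ddH (\<xi> t) \<xi>' E3 = 0\<close>: the vertical momentum is conserved. This removes the
    only term that still depends on the position \<open>c t\<close>.\<close>
  have "(\<forall>w. (?p w has_real_derivative ?q w) (at t)) \<longleftrightarrow>
      (\<forall>w. ddH (\<xi> t) \<xi>' w = dH (\<xi> t) E3 * snd (heis_bracket (\<xi> t) w))"
    unfolding EL \<eta>_def[symmetric] \<beta>
  proof (intro iffI allI)
    fix w
    assume *: "\<forall>w. ddH (\<xi> t) \<xi>' w - (1/2) * \<beta> (c t) w * ddH (\<xi> t) \<xi>' E3 = \<eta> * \<beta> (v t) w"
    have "ddH (\<xi> t) \<xi>' E3 = 0"
      using *[rule_format, of E3] by (simp add: E3)
    then show "ddH (\<xi> t) \<xi>' w = \<eta> * \<beta> (v t) w"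
      using *[rule_format, of w] by simp
  next
    fix w
    assume *: "\<forall>w. ddH (\<xi> t) \<xi>' w = \<eta> * \<beta> (v t) w"
    have "ddH (\<xi> t) \<xi>' E3 = 0"
      using *[rule_format, of E3] by (simp add: E3)
    then show "ddH (\<xi> t) \<xi>' w - (1/2) * \<beta> (c t) w * ddH (\<xi> t) \<xi>' E3 = \<eta> * \<beta> (v t) w"
      using *[rule_format, of w] by simp
  qed
  also have "\<dots> \<longleftrightarrow> \<xi>' = rot_speed (\<xi> t) *\<^sub>R derD (\<xi> t)"
    by (rule ddH_eq_iff[OF nz])
  also have "\<dots> \<longleftrightarrow> (\<xi> has_vector_derivative rot_speed (\<xi> t) *\<^sub>R derD (\<xi> t)) (at t)"
    using d\<xi> vector_derivative_unique_at by blast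
  finally show ?thesis .
qed

end

section \<open>Geodesics through the origin as orbits\<close>

lemma smooth_onD:
  assumes "smooth_on I c" "open I" "t \<in> I"
  shows "(c has_vector_derivative velocity c t) (at t)" "velocity c differentiable (at t)"
proof -
  have C2: "Ck_on 2 I c" using assms(1) by (simp add: smooth_on_def)
  have vd: "(c has_vector_derivative velocity c t) (at t)" if "t \<in> I" for t
    using C2 that by (simp add: velocity_def numeral_2_eq_2 vector_derivative_works[symmetric])
  then show "(c has_vector_derivative velocity c t) (at t)" using assms(3) by blast
  have "frechet_derivative c (at \<tau>) 1 = velocity c \<tau>" if "\<tau> \<in> I" for \<tau>
    using C2 that by (simp add: frechet_derivative_eq_vector_derivative velocity_def numeral_2_eq_2)
  moreover have "(\<lambda>\<tau>. frechet_derivative c (at \<tau>) 1) differentiable (at t)"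
    using C2 assms(3) by (simp add: numeral_2_eq_2)
  then obtain D where "((\<lambda>\<tau>. frechet_derivative c (at \<tau>) 1) has_derivative D) (at t)"
    by (auto simp: differentiable_def)
  ultimately have "(velocity c has_derivative D) (at t)"
    using has_derivative_transform_within_open[OF _ assms(2,3)] by blast
  then show "velocity c differentiable (at t)"
    by (rule differentiableI)
qed

lemma smooth_on_orb: "smooth_on UNIV (orb y)"
proof -
  obtain w s k where y: "y = ((w, s), k)" by (metis prod.exhaust)
  have "Ck_on n UNIV (orb y)" for n
  proof (cases "k = 0")
    case True
    have "Ck_on n UNIV (\<lambda>t. t *\<^sub>R (w, s))"
      by (intro Ck_on_linear[OF bounded_linear_scaleR_left] Ck_on_id) auto
    moreover have "orb y = (\<lambda>t. t *\<^sub>R (w, s))"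
      by (auto simp: orb_def y True)
    ultimately show ?thesis by simp
  next
    case False
    \<comment> \<open>The helix is a combination of the scalar functions \<open>t\<close>,
      \<open>cos (k * t)\<close> and \<open>sin (k * t)\<close> with constant vector
      coefficients.\<close>
    have "Ck_on n UNIV (\<lambda>t. t *\<^sub>R (0, s + (norm w)\<^sup>2 / (2 * k)) + ((\<i> * w / k, 0)
       + (cos (k * t) *\<^sub>R (- (\<i> * w / k), 0) + sin (k * t) *\<^sub>R (w / k, - ((norm w)\<^sup>2 / (2 * k\<^sup>2))))))"
      using Ck_on_cos_sin
      by (intro Ck_on_add Ck_on_const Ck_on_linear[OF bounded_linear_scaleR_left] Ck_on_id) auto
    moreover have "orb y = (\<lambda>t. t *\<^sub>R (0, s + (norm w)\<^sup>2 / (2 * k)) + ((\<i> * w / k, 0)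
       + (cos (k * t) *\<^sub>R (- (\<i> * w / k), 0) + sin (k * t) *\<^sub>R (w / k, - ((norm w)\<^sup>2 / (2 * k\<^sup>2))))))"
      using False by (auto simp: orb_def y fun_eq_iff complex_eq_iff algebra_simps add_divide_distrib diff_divide_distrib)
    ultimately show ?thesis by simp
  qed
  then show ?thesis by (simp add: smooth_on_def)
qed

text \<open>The velocity of an orbit determines its body velocity; time 0 gives
  \<open>fst y\<close>, and the rotation rate can be read off from the turning horizontal part. That
  part must be nonzero: a vertical line is an orbit for every value of \<open>snd y\<close>.\<close>

lemma orb_inject:
  assumes "\<And>t. orb y t = orb z t" "fst (fst y) \<noteq> 0"
  shows "y = z"
proof -
  have "rot (cis (snd y * t)) (fst y) = rot (cis (snd z * t)) (fst z)" for t
  proof -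
    have y: "(orb y has_vector_derivative rot (cis (snd y * t)) (fst y) +
        (1/2) *\<^sub>R heis_bracket (orb y t) (rot (cis (snd y * t)) (fst y))) (at t)"
      using orb_has_body_velocity[of y t] by (simp add: has_body_velocity_def)
    have "orb y = orb z" using assms(1) by auto
    then have "has_body_velocity (orb y) (\<lambda>t. rot (cis (snd z * t)) (fst z)) t"
      using orb_has_body_velocity[of z t] by simp
    then show ?thesis
      unfolding has_body_velocity_iff[OF y] by (simp add: body_velocity_inverse)
  qed
  note eq = this
  have 1: "fst y = fst z" using eq[of 0] by (simp add: rot_def)
  have "cis (snd y * t) = cis (snd z * t)" for t
    using eq[of t] assms(2) by (simp add: rot_def 1)
  then have "((\<lambda>t. cis (snd z * t)) has_vector_derivative \<i> * (snd y * cis (snd y * 0))) (at 0)"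
    using has_vector_derivative_cis[of "snd y" 0 UNIV] by simp
  then have "\<i> * (snd y * cis (snd y * 0)) = \<i> * (snd z * cis (snd z * 0))"
    using has_vector_derivative_cis vector_derivative_unique_at by blast
  then show ?thesis using 1 by (simp add: prod_eq_iff)
qed

context two_metrics
begin

text \<open>Rotation invariance of \<open>rot_speed\<close>, in the form that turns conserved
  quantities into a constant rotation speed.\<close>

lemma rot_speed_cong:
  assumes "norm (fst x) = norm (fst y)" "snd x = snd y"
  shows "rot_speed x = rot_speed y"
  using assms by (simp add: rot_speed_def quad_def dot_square_norm)

text \<open>Since \<open>D\<close> is skew and has no vertical part, the equation for \<xi>
  conserves \<open>norm (fst (\<xi> t))\<close> and \<open>snd (\<xi> t)\<close>, hence also
  \<open>rot_speed (\<xi> t)\<close>. The equation thus becomes a linear rotation equation, and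
  \<xi> is the body velocity of an orbit.\<close>

lemma geodesic_is_orbit:
  assumes geo: "geodesic_on F I c" and I: "0 \<in> I" "c 0 = origin" and t: "t \<in> I"
  shows "c t = orb (velocity c 0, rot_speed (velocity c 0)) t"
proof -
  define \<xi> where "\<xi> \<tau> = body_velocity (c \<tau>) (velocity c \<tau>)" for \<tau>
  have "open I" and int: "is_interval I" and sm: "smooth_on I c"
    using geo by (auto simp: geodesic_on_def)
  note vel = smooth_onD(1)[OF sm \<open>open I\<close>]
  have d\<xi>: "(\<xi> has_vector_derivative rot_speed (\<xi> \<tau>) *\<^sub>R derD (\<xi> \<tau>)) (at \<tau>)" if "\<tau> \<in> I" for \<tau>
  proof -
    have "(velocity c has_vector_derivative vector_derivative (velocity c) (at \<tau>)) (at \<tau>)"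
      using smooth_onD(2)[OF sm \<open>open I\<close> that] by (simp add: vector_derivative_works)
    from euler_lagrange_iff[OF \<open>open I\<close> that vel _ this \<xi>_def] show ?thesis
      using geo that by (auto simp: geodesic_on_def)
  qed
  have dfst: "((\<lambda>\<tau>. fst (\<xi> \<tau>)) has_vector_derivative \<i> * (rot_speed (\<xi> \<tau>) * fst (\<xi> \<tau>))) (at \<tau>)"
    if "\<tau> \<in> I" for \<tau>
    using bounded_linear.has_vector_derivative[OF bounded_linear_fst d\<xi>[OF that]]
    by (simp add: derD_def scaleR_conv_of_real mult.left_commute)
  have "((\<lambda>\<tau>. fst (\<xi> \<tau>) \<bullet> fst (\<xi> \<tau>)) has_vector_derivative 0) (at \<tau> within I)"
    if "\<tau> \<in> I" for \<tau>
    by (rule has_vector_derivative_at_within, rule has_vector_derivative_eq_rhs[OF bounded_bilinear.has_vector_derivative[OF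
          bounded_bilinear_inner dfst[OF that] dfst[OF that]]])
       (simp add: inner_complex_def algebra_simps)
  then have "fst (\<xi> \<tau>) \<bullet> fst (\<xi> \<tau>) = fst (\<xi> 0) \<bullet> fst (\<xi> 0)" if "\<tau> \<in> I" for \<tau>
    by (rule interval_constant[OF int I(1) that])
  then have n: "norm (fst (\<xi> \<tau>)) = norm (fst (\<xi> 0))" if "\<tau> \<in> I" for \<tau>
    using that by (simp add: norm_eq)
  have "((\<lambda>\<tau>. snd (\<xi> \<tau>)) has_vector_derivative 0) (at \<tau> within I)" if "\<tau> \<in> I" for \<tau>
    using has_vector_derivative_at_within[OF
        bounded_linear.has_vector_derivative[OF bounded_linear_snd d\<xi>[OF that]]]
    by (simp add: derD_def)
  then have s: "snd (\<xi> \<tau>) = snd (\<xi> 0)" if "\<tau> \<in> I" for \<tau>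
    by (rule interval_constant[OF int I(1) that])
  define k where "k = rot_speed (\<xi> 0)"
  have k: "rot_speed (\<xi> \<tau>) = k" if "\<tau> \<in> I" for \<tau>
    unfolding k_def using n[OF that] s[OF that] by (rule rot_speed_cong)
  have "((\<lambda>\<tau>. fst (\<xi> \<tau>)) has_vector_derivative \<i> * (k * fst (\<xi> \<tau>))) (at \<tau> within I)"
    if "\<tau> \<in> I" for \<tau>
    using has_vector_derivative_at_within[OF dfst[OF that]] by (simp only: k[OF that])
  then have "fst (\<xi> \<tau>) = cis (k * \<tau>) * fst (\<xi> 0)" if "\<tau> \<in> I" for \<tau>
    by (rule rotation_ode[where u = "\<lambda>\<tau>. fst (\<xi> \<tau>)", OF int I(1) that])
  then have \<xi>: "\<xi> \<tau> = rot (cis (k * \<tau>)) (\<xi> 0)" if "\<tau> \<in> I" for \<tau>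
    using s that by (simp add: rot_def prod_eq_iff)
  \<comment> \<open>At the origin the bracket correction vanishes, so body velocity and velocity
    coincide.\<close>
  have \<xi>0: "\<xi> 0 = velocity c 0"
    by (simp add: \<xi>_def I(2) origin_def body_velocity_def heis_bracket_def zero_prod_def[symmetric])
  show ?thesis
  proof (rule has_body_velocity_unique[where x = c, OF int I(1) t])
    show "has_body_velocity c (\<lambda>\<tau>. rot (cis (k * \<tau>)) (\<xi> 0)) \<tau>" if "\<tau> \<in> I" for \<tau>
      unfolding has_body_velocity_iff[OF vel[OF that]] using \<xi>[OF that] by (simp add: \<xi>_def)
    show "has_body_velocity (orb (velocity c 0, rot_speed (velocity c 0))) (\<lambda>\<tau>. rot (cis (k * \<tau>)) (\<xi> 0)) \<tau>" for \<tau>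
      using orb_has_body_velocity[of "(velocity c 0, rot_speed (velocity c 0))"]
      by (simp add: \<xi>0 k_def)
  qed (simp add: I(2) origin_def)
qed

lemma geodesic_orbit_F: "geodesic_orbit F"
  unfolding geodesic_orbit_def geodesics_are_orbits_of_def G_act_lie_exp
proof (intro allI impI)
  fix I c assume c: "geodesic_on F I c \<and> 0 \<in> I \<and> c 0 = origin"
  then have "\<forall>t\<in>I. c t = orb (velocity c 0, rot_speed (velocity c 0)) t"
    using geodesic_is_orbit[of I c] by blast
  then show "\<exists>y\<in>UNIV. \<forall>t\<in>I. c t = orb y t" by blast
qed

text \<open>Natural reductivity constrains only curves already known to be geodesics; this existence
  statement supplies the ones that refute it.\<close>

lemma orb_geodesic:
  assumes "x \<noteq> 0"
  shows "geodesic_on F UNIV (orb (x, rot_speed x))"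
proof -
  define c where "c = orb (x, rot_speed x)"
  define \<xi> where "\<xi> t = rot (cis (rot_speed x * t)) x" for t
  have "has_body_velocity c \<xi> t" for t
    using orb_has_body_velocity[of "(x, rot_speed x)" t] by (simp add: c_def \<xi>_def[abs_def])
  then have c: "(c has_vector_derivative \<xi> t + (1/2) *\<^sub>R heis_bracket (c t) (\<xi> t)) (at t)" for t
    by (simp add: has_body_velocity_def)
  have vel: "velocity c t = \<xi> t + (1/2) *\<^sub>R heis_bracket (c t) (\<xi> t)" for t
    using c by (simp add: velocity_def vector_derivative_at)
  have sm: "smooth_on UNIV c" unfolding c_def by (rule smooth_on_orb)
  have \<xi>_vel: "\<xi> t = body_velocity (c t) (velocity c t)" for t
    by (simp add: vel body_velocity_inverse)
  have "\<xi> t \<noteq> 0" for t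
    using assms by (simp add: \<xi>_def rot_def prod_eq_iff)
  then have nz: "velocity c t \<noteq> 0" for t
    using \<xi>_vel[of t] by (metis body_velocity_eq_0_iff)
  have "rot_speed (\<xi> t) = rot_speed x" for t
    by (rule rot_speed_cong) (simp_all add: \<xi>_def rot_def norm_mult)
  then have "rot_speed (\<xi> t) *\<^sub>R derD (\<xi> t) = (\<i> * (rot_speed x * cis (rot_speed x * t)) * fst x, 0)" for t
    by (simp add: derD_def \<xi>_def rot_def scaleR_conv_of_real algebra_simps)
  moreover have "(\<xi> has_vector_derivative (\<i> * (rot_speed x * cis (rot_speed x * t)) * fst x, 0)) (at t)" for t
    unfolding \<xi>_def rot_def
    by (intro has_vector_derivative_Pair has_vector_derivative_mult_left has_vector_derivative_cis
        has_vector_derivative_const)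
  ultimately have d\<xi>: "(\<xi> has_vector_derivative rot_speed (\<xi> t) *\<^sub>R derD (\<xi> t)) (at t)" for t
    by simp
  have "(velocity c has_vector_derivative vector_derivative (velocity c) (at t)) (at t)" for t
    using smooth_onD(2)[OF sm open_UNIV UNIV_I] by (simp add: vector_derivative_works)
  from euler_lagrange_iff[OF open_UNIV UNIV_I smooth_onD(1)[OF sm open_UNIV] nz this \<xi>_vel]
  show ?thesis
    unfolding geodesic_on_def c_def[symmetric] using sm nz d\<xi> by simp
qed

end

section \<open>Invariant complements and natural reductivity\<close>

text \<open>A complement of \<open>lie_h\<close> is the graph of a linear functional on the
  Heisenberg algebra. The rotation by -1 negates horizontal vectors and fixes \<open>E3\<close> and
  \<open>D\<close>, so an invariant functional vanishes on \<open>span(E1, E2)\<close> and is a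
  multiple \<open>l\<close> of the \<open>E3\<close>-coordinate.\<close>

lemma reductive_complement_graph:
  assumes "reductive_complement m"
  obtains l where "\<And>y. y \<in> m \<Longrightarrow> snd y = l * snd (fst y)"
proof -
  have sub: "subspace m" and int: "m \<inter> lie_h = {0}"
    and cover: "{x + h |x h. x \<in> m \<and> h \<in> lie_h} = UNIV"
    and Ad: "\<And>u. u \<in> SO2 \<Longrightarrow> Ad_H u ` m \<subseteq> m"
    using assms by (auto simp: reductive_complement_def)
  have ex: "\<exists>r. (X, r) \<in> m" for X
  proof -
    have "(X, 0) \<in> {x + h |x h. x \<in> m \<and> h \<in> lie_h}" unfolding cover by simp
    then obtain x h where "(X, 0) = x + h" "x \<in> m" "h \<in> lie_h" by blast
    then show ?thesis by (cases x; cases h) (auto simp: lie_h_def)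
  qed
  have vert: "r = 0" if "(0, r) \<in> m" for r
  proof -
    have "(0, r) \<in> m \<inter> lie_h" using that by (simp add: lie_h_def)
    then show ?thesis unfolding int by (simp add: zero_prod_def)
  qed
  obtain l where l: "(E3, l) \<in> m" using ex by blast
  have hor: "((w, 0), 0) \<in> m" for w
  proof -
    obtain r where r: "((w, 0), r) \<in> m" using ex by blast
    have "- 1 \<in> SO2" by (simp add: SO2_def)
    from Ad[OF this] r have "Ad_H (- 1) ((w, 0), r) \<in> m" by blast
    \<comment> \<open>The horizontal parts cancel, which puts the sum into \<open>lie_h\<close> as
      well as into \<open>m\<close>.\<close>
    then have "((w, 0), r) + Ad_H (- 1) ((w, 0), r) \<in> m"
      using r subspace_add[OF sub] by blast
    then have "(0, 2 * r) \<in> m" by (simp add: Ad_H_def rot_def zero_prod_def)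
    then have "r = 0" using vert by fastforce
    then show ?thesis using r by simp
  qed
  have "snd y = l * snd (fst y)" if "y \<in> m" for y
  proof -
    obtain w s k where y: "y = ((w, s), k)" by (metis prod.exhaust)
    have "y - ((w, 0), 0) - s *\<^sub>R (E3, l) \<in> m"
      using that hor l sub by (intro subspace_diff subspace_scale) auto
    then have "(0, k - s * l) \<in> m" by (simp add: y E3_def zero_prod_def)
    then show ?thesis using vert by (fastforce simp: y)
  qed
  then show ?thesis by (rule that)
qed

context two_metrics
begin

lemma not_naturally_reductive_F:
  assumes "a \<noteq> b"
  shows "\<not> naturally_reductive F"
proof
  assume "naturally_reductive F"
  then obtain m where m: "reductive_complement m" and orbits: "geodesics_are_orbits_of F m"
    by (auto simp: naturally_reductive_def)
  obtain l where l: "\<And>y. y \<in> m \<Longrightarrow> snd y = l * snd (fst y)"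
    using reductive_complement_graph[OF m] by blast
  \<comment> \<open>The horizontal part 1 is nonzero, so \<open>orb_inject\<close> identifies the
    generator of the geodesic with the element of \<open>m\<close>.\<close>
  have rot_speed: "rot_speed (1, s) = l * s" for s
  proof -
    have "geodesic_on F UNIV (orb ((1, s), rot_speed (1, s)))"
      by (rule orb_geodesic) (simp add: zero_prod_def)
    moreover have "orb ((1, s), rot_speed (1, s)) 0 = origin" by (simp add: origin_def)
    ultimately have "\<exists>y\<in>m. \<forall>t\<in>UNIV. orb ((1, s), rot_speed (1, s)) t = orb y t"
      using orbits unfolding geodesics_are_orbits_of_def G_act_lie_exp by blast
    then obtain y where "y \<in> m" and y: "\<And>t. orb ((1, s), rot_speed (1, s)) t = orb y t"
      by blast
    have "((1, s), rot_speed (1, s)) = y" by (rule orb_inject[OF y]) simp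
    then show ?thesis using l[OF \<open>y \<in> m\<close>] by force
  qed
  \<comment> \<open>Two heights, \<open>s = 1\<close> and \<open>s = 2\<close>, suffice: eliminating
    \<open>l\<close> leaves \<open>3 * (a - b)^2 = 0\<close>.\<close>
  have "a * (1 + a) + b * (1 + b) = l * (2 + a + b)"
    using rot_speed[of 1] a_pos b_pos by (simp add: rot_speed_def quad_def field_simps)
  moreover have "a * (1 + 4 * a) + b * (1 + 4 * b) = l * (2 + 4 * a + 4 * b)"
    using rot_speed[of 2] a_pos b_pos by (simp add: rot_speed_def quad_def field_simps)
  ultimately have "(a * (1 + a) + b * (1 + b)) * (2 + 4 * a + 4 * b)
      = (a * (1 + 4 * a) + b * (1 + 4 * b)) * (2 + a + b)"
    by (simp only:) (simp add: algebra_simps)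
  moreover have "(a * (1 + 4 * a) + b * (1 + 4 * b)) * (2 + a + b)
      - (a * (1 + a) + b * (1 + b)) * (2 + 4 * a + 4 * b) = 3 * (a - b)\<^sup>2"
    by (simp add: power2_eq_square algebra_simps)
  ultimately have "(a - b)\<^sup>2 = 0" by simp
  then show False using assms by simp
qed

end

text \<open>The slope \<open>c\<close> of \<open>m\<close> is chosen so that the scalar product of
  \<open>[z, x]\<close> with \<open>y\<close> becomes \<open>c\<close> times the cyclic sum of one
  vertical coordinate times the bracket of the other two vectors. This sum is alternating, hence
  changes sign when \<open>x\<close> and \<open>y\<close> are exchanged.\<close>

lemma naturally_reductive_riemannian_quad:
  assumes "c > 0"
  shows "naturally_reductive_riemannian (quad c)"
proof -
  define m :: "lie_g set" where "m = {y. snd y = c * snd (fst y)}"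
  have "invariant_riemannian (quad c)"
    using assms by (simp add: invariant_riemannian_def bilinear_conv_bounded_bilinear
        bounded_bilinear_quad quad_commute[of c] quad_pos quad_rot)
  moreover have "reductive_complement m"
  proof -
    have "\<exists>x h. y = x + h \<and> x \<in> m \<and> h \<in> lie_h" for y
      by (rule exI[of _ "(fst y, c * snd (fst y))"], rule exI[of _ "(0, snd y - c * snd (fst y))"])
         (simp add: m_def lie_h_def prod_eq_iff)
    moreover have "subspace m"
      by (auto simp: subspace_def m_def algebra_simps)
    moreover have "m \<inter> lie_h = {0}"
      by (auto simp: m_def lie_h_def zero_prod_def)
    moreover have "Ad_H u ` m \<subseteq> m" for u
      by (auto simp: m_def Ad_H_def rot_def)
    ultimately show ?thesis by (auto simp: reductive_complement_def)
  qed
  moreover have "quad c (fst (proj_along_h m (lie_bracket z x))) (fst y) +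
      quad c (fst x) (fst (proj_along_h m (lie_bracket z y))) = 0"
    if "x \<in> m" "y \<in> m" "z \<in> m" for x y z
  proof -
    have "fst (proj_along_h m v) = fst v" for v
    proof -
      have "proj_along_h m v = (fst v, c * snd (fst v))"
        unfolding proj_along_h_def
        by (rule the_equality) (auto simp: m_def lie_h_def mem_Times_iff prod_eq_iff)
      then show ?thesis by simp
    qed
    then show ?thesis
      using that
      by (simp add: m_def lie_bracket_def quad_def heis_bracket_def derD_def inner_complex_def algebra_simps)
  qed
  ultimately show ?thesis
    unfolding naturally_reductive_riemannian_def by blast
qed

section \<open>The infinite family with \<open>a = 1\<close> and \<open>b > 1\<close>\<close>

theorem corollary10:
  shows "\<exists>\<F> :: (heis \<Rightarrow> real) set. infinite \<F> \<and>
    (\<forall>F\<in>\<F>.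
       alpha12_metric F \<and>
       (\<exists>g1 g2 L.
          naturally_reductive_riemannian g1 \<and> naturally_reductive_riemannian g2 \<and>
          admissible L \<and>
          (\<forall>y. F y = sqrt (L (sqrt (g1 y y), sqrt (g2 y y))))) \<and>
       geodesic_orbit F \<and>
       \<not> naturally_reductive F)"
proof -
  \<comment> \<open>One parameter is fixed at 1 and the other exceeds 1, so the two always
    differ.\<close>
  let ?\<F> = "two_metrics.F 1 ` {1<..}"
  have loc: "two_metrics 1 c" if "c \<in> {1<..}" for c :: real
    using that by unfold_locales auto
  have "inj_on (two_metrics.F 1) {1<..}"
  proof (rule inj_onI)
    fix c d :: real
    assume c: "c \<in> {1<..}" and d: "d \<in> {1<..}" and eq: "two_metrics.F 1 c = two_metrics.F 1 d"
    \<comment> \<open>The horizontal restriction of the norm is the same for all \<open>c\<close>;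
      the value at \<open>E3\<close> tells the members apart.\<close>
    have E3: "two_metrics.F 1 c E3 = sqrt (sqrt (1 + c\<^sup>2))" if "c \<in> {1<..}" for c
      using loc[OF that] by (simp add: two_metrics.F_def two_metrics.P_def quad_def E3_def)
    have "sqrt (sqrt (1 + c\<^sup>2)) = sqrt (sqrt (1 + d\<^sup>2))"
      unfolding E3[OF c, symmetric] E3[OF d, symmetric] eq by (rule refl)
    then have "c\<^sup>2 = d\<^sup>2" by simp
    then show "c = d" using c d by (simp add: power2_eq_iff_nonneg)
  qed
  then have "infinite ?\<F>"
    by (simp add: finite_image_iff infinite_Ioi)
  moreover have "alpha12_metric F \<and>
       (\<exists>g1 g2 L.
          naturally_reductive_riemannian g1 \<and> naturally_reductive_riemannian g2 \<and>
          admissible L \<and>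
          (\<forall>y. F y = sqrt (L (sqrt (g1 y y), sqrt (g2 y y))))) \<and>
       geodesic_orbit F \<and> \<not> naturally_reductive F" if "F \<in> ?\<F>" for F
  proof -
    obtain c where c: "c > 1" "F = two_metrics.F 1 c" using \<open>F \<in> ?\<F>\<close> by auto
    interpret two_metrics 1 c by (rule loc) (use c in simp)
    let ?L = "\<lambda>p::real \<times> real. sqrt (fst p ^ 4 + snd p ^ 4)"
    have "F y = sqrt (?L (sqrt (quad 1 y y), sqrt (quad c y y)))" for y
    proof -
      \<comment> \<open>\<open>L\<close> receives the square roots of the quadratic forms, so its
        fourth powers restore the squares in \<open>P\<close>.\<close>
      have "sqrt q ^ 4 = q\<^sup>2" if "q \<ge> 0" for q
        using that power_mult[of "sqrt q" 2 2] by simp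
      moreover have "quad 1 y y \<ge> 0" "quad c y y \<ge> 0"
        using c by (simp_all add: quad_def)
      ultimately show ?thesis
        using c(2) by (simp add: F_def P_def)
    qed
    moreover have "naturally_reductive_riemannian (quad 1)" "naturally_reductive_riemannian (quad c)"
      using c by (simp_all add: naturally_reductive_riemannian_quad)
    ultimately have "\<exists>g1 g2 L.
          naturally_reductive_riemannian g1 \<and> naturally_reductive_riemannian g2 \<and>
          admissible L \<and>
          (\<forall>y. F y = sqrt (L (sqrt (g1 y y), sqrt (g2 y y))))"
      using admissible_sqrt_quartic
      by (intro exI[of _ "quad 1"] exI[of _ "quad c"] exI[of _ ?L] conjI allI)
    moreover have "\<not> naturally_reductive F"
      unfolding c(2) using c(1) by (intro not_naturally_reductive_F) simp
    ultimately show ?thesis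
      using alpha12_metric_F geodesic_orbit_F unfolding c(2) by (intro conjI)
  qed
  ultimately show ?thesis
    by (intro exI[of _ ?\<F>] conjI[OF _ ballI])
qed

end
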